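(* Let $\mathcal L=\sum_{\boldsymbol m\in\mathcal M(c)}a_{\boldsymbol m}\partial^{\boldsymbol m}$ be a constant-coefficient linear scalar partial differential operator of order $c$ in $d$ dimensions, let $G$ be a kernel with $\mathcal LG=0$ on $\mathbb R^d\setminus\{\boldsymbol 0\}$, and let $\boldsymbol c_1\neq\boldsymbol c_2\in\mathbb R^d$. Translating a multipole expansion of order $p$ in compressed representation around center $\boldsymbol c_1$ to a local expansion of order $p$ in compressed representation around center $\boldsymbol c_2$ (the problem defined in the context, where quantities depending only on $G$, $p$ and $\boldsymbol c_2-\boldsymbol c_1$ are precomputed and not counted) can be achieved, as $p\to\infty$, with (i) $O(p^{d-1}\log p)$ work in $d$ dimensions if $a_{c\boldsymbol e_i}\ne 0$ for some $i\in\{1,\dots,d\}$, for a suitable choice (depending on $\mathcal L$) of the graded monomial ordering $\boldsymbol\nu$ defining the compressed representation; (ii) $O(p^2)$ work in two dimensions ($d=2$); (iii) $O(p^d\log p)$ work in $d$ dimensions. In (ii) and (iii) no condition on the coefficients of $\mathcal L$ is required.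
   Context: Notation. $d\ge1$; $\boldsymbol e_i$ is the $i$th standard unit multi-index; for $\boldsymbol q\in\mathbb N_0^d$, $|\boldsymbol q|=\sum_i q_i$, $\boldsymbol q!=\prod_i q_i!$, $\boldsymbol x^{\boldsymbol q}=\prod_i x_i^{q_i}$, $\partial^{\boldsymbol q}=\prod_i\partial_{x_i}^{q_i}$, and $\boldsymbol m\ge\boldsymbol n$ is meant componentwise. $\mathcal M(p)=\{\boldsymbol q\in\mathbb N_0^d:|\boldsymbol q|\le p\}$, $N(p)=|\mathcal M(p)|$. $\mathcal L$ has order $c\ge1$: $a_{\boldsymbol m}\in\mathbb C$ and $a_{\boldsymbol m}\ne0$ for some $|\boldsymbol m|=c$. Expansion orders satisfy $p\ge c$, and $G:\mathbb R^d\setminus\{\boldsymbol 0\}\to\mathbb C$ is $C^{2p}$ for every order $p$ considered. Write $G^{(\boldsymbol q)}=\partial^{\boldsymbol q}G$. Graded monomial ordering: a bijection $\boldsymbol\nu:\mathbb N=\{1,2,\dots\}\to\mathbb N_0^d$ with $\boldsymbol\nu(1)=\boldsymbol 0$; $|\boldsymbol\nu(i)|<|\boldsymbol\nu(j)|\Rightarrow i<j$; and $i<j\Rightarrow\boldsymbol\nu^{-1}(\boldsymbol\nu(i)+\boldsymbol\nu(k))<\boldsymbol\nu^{-1}(\boldsymbol\nu(j)+\boldsymbol\nu(k))$ for all $i,j,k$. Fix one. Compression. Let $P\in\mathbb C^{N(p-c)\times N(p)}$, $P_{i_1,i_2}=b_{\boldsymbol\nu(i_1),\boldsymbol\nu(i_2)}$,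 where $b_{\boldsymbol n,\boldsymbol m}=a_{\boldsymbol m-\boldsymbol n}$ if $\boldsymbol m\ge\boldsymbol n$ and $\boldsymbol m-\boldsymbol n\in\mathcal M(c)$, and $0$ otherwise. Let $h(i)$ be the index of the last nonzero column in row $i$ of $P$, $\bar{\boldsymbol j}=\{h(1),\dots,h(N(p-c))\}$ and $\boldsymbol j=\{1,\dots,N(p)\}\setminus\bar{\boldsymbol j}$. The submatrix $P_{[:,\bar{\boldsymbol j}]}$ of the columns $\bar{\boldsymbol j}$ is square and invertible. The decompression matrix $M$, with $N(p)$ rows and columns indexed by $\boldsymbol j$, has $M_{[\boldsymbol j,:]}=I$ and $M_{[\bar{\boldsymbol j},:]}=-P_{[:,\bar{\boldsymbol j}]}^{-1}P_{[:,\boldsymbol j]}$. A multipole expansion of order $p$ around $\boldsymbol c_1$ with uncompressed coefficients $\boldsymbol\alpha_i=\sum_{\boldsymbol y\in S}(\boldsymbol c_1-\boldsymbol y)^{\boldsymbol\nu(i)}/\boldsymbol\nu(i)!$, $1\le i\le N(p)$ ($S$ a finite set of sources), represents the function $\boldsymbol x\mapsto\sum_{i=1}^{N(p)}\boldsymbol\alpha_iG^{(\boldsymbol\nu(i))}(\boldsymbol x-\boldsymbol c_1)$; its compressed coefficients are $\boldsymbol\beta=M^T\boldsymbol\alpha=(\boldsymbol\beta_q)_{q\in\boldsymbol j}$, and it equals $\sum_{q\in\boldsymbol j}\boldsymbol\beta_qG^{(\boldsymbol\nu(q))}(\boldsymbol x-\boldsymbol c_1)$. Translation problem (multipole-to-local):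 given the compressed coefficients $(\boldsymbol\beta_q)_{q\in\boldsymbol j}$ around $\boldsymbol c_1$, compute, for all $i\in\boldsymbol j$, the compressed-representation coefficients of the local (Taylor) expansion around $\boldsymbol c_2$, $$\boldsymbol\gamma_i=\frac1{\boldsymbol\nu(i)!}\sum_{q\in\boldsymbol j}G^{(\boldsymbol\nu(q)+\boldsymbol\nu(i))}(\boldsymbol c_2-\boldsymbol c_1)\,\boldsymbol\beta_q .$$ Work is the number of scalar arithmetic operations in $\mathbb C$. The derivatives $G^{(\boldsymbol n)}(\boldsymbol c_2-\boldsymbol c_1)$, $|\boldsymbol n|\le2p$, and anything depending only on them and $p$ (e.g. their discrete Fourier transform) are precomputed and not counted. Implied constants may depend on $d$, $\mathcal L$ and $\boldsymbol\nu$ but not on $p$. *)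

theory Defs
  imports "HOL-Analysis.Analysis" "HOL-Library.Landau_Symbols"
begin

text \<open>
  Multi-indices are vectors \<open>nat ^ 'd\<close>, with the componentwise order, sum and difference;
  \<open>axis i k\<close> is \<open>k\<close> times the \<open>i\<close>-th unit multi-index, and the dimension is \<open>CARD('d)\<close>.
\<close>

section \<open>Multi-indices\<close>

definition msize :: "nat ^ 'd \<Rightarrow> nat" where
  "msize q = (\<Sum>i\<in>UNIV. q $ i)"

definition mfact :: "nat ^ 'd \<Rightarrow> nat" where
  "mfact q = (\<Prod>i\<in>UNIV. fact (q $ i))"

definition mindices :: "nat \<Rightarrow> (nat ^ 'd) set" where
  "mindices p = {q. msize q \<le> p}"

definition graded_monomial_ordering :: "(nat \<Rightarrow> nat ^ 'd) \<Rightarrow> bool" where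
  "graded_monomial_ordering \<nu> \<longleftrightarrow>
     bij_betw \<nu> {1..} UNIV \<and>
     \<nu> 1 = 0 \<and>
     (\<forall>i\<ge>1. \<forall>j\<ge>1. msize (\<nu> i) < msize (\<nu> j) \<longrightarrow> i < j) \<and>
     (\<forall>i\<ge>1. \<forall>j\<ge>1. \<forall>k\<ge>1. i < j \<longrightarrow>
        inv_into {1..} \<nu> (\<nu> i + \<nu> k) < inv_into {1..} \<nu> (\<nu> j + \<nu> k))"

section \<open>Iterated partial derivatives and the differential operator\<close>

definition partial :: "'d \<Rightarrow> (real ^ 'd \<Rightarrow> complex) \<Rightarrow> real ^ 'd \<Rightarrow> complex" where
  "partial i f x = vector_derivative (\<lambda>t. f (x + t *\<^sub>R axis i 1)) (at 0)"

text \<open>\<open>C\<^sup>k\<close> on an open set: all iterated partial derivatives up to order \<open>k\<close> exist and are continuous.\<close>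

primrec Ck_on :: "nat \<Rightarrow> (real ^ 'd \<Rightarrow> complex) \<Rightarrow> (real ^ 'd) set \<Rightarrow> bool" where
  "Ck_on 0 f S \<longleftrightarrow> continuous_on S f"
| "Ck_on (Suc k) f S \<longleftrightarrow>
     continuous_on S f \<and>
     (\<forall>i. (\<forall>x\<in>S. (\<lambda>t. f (x + t *\<^sub>R axis i 1)) differentiable (at 0)) \<and> Ck_on k (partial i f) S)"

text \<open>
  The product of the powers of the partial derivatives is taken along an arbitrary fixed enumeration
  of the coordinates.  On functions of class \<open>C\<^sup>k\<close> with \<open>k \<ge> |q|\<close> the enumeration is irrelevant
  by symmetry of mixed partial derivatives.
\<close>

definition mderiv :: "nat ^ 'd \<Rightarrow> (real ^ 'd \<Rightarrow> complex) \<Rightarrow> real ^ 'd \<Rightarrow> complex" where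
  "mderiv q f =
     foldr (\<lambda>i. partial i ^^ (q $ i)) (SOME is. distinct is \<and> set is = (UNIV :: 'd set)) f"

definition diff_op :: "(nat ^ 'd \<Rightarrow> complex) \<Rightarrow> nat \<Rightarrow> (real ^ 'd \<Rightarrow> complex) \<Rightarrow> real ^ 'd \<Rightarrow> complex" where
  "diff_op a c f x = (\<Sum>m\<in>mindices c. a m * mderiv m f x)"

definition is_kernel :: "(nat ^ 'd \<Rightarrow> complex) \<Rightarrow> nat \<Rightarrow> nat \<Rightarrow> (real ^ 'd \<Rightarrow> complex) \<Rightarrow> bool" where
  "is_kernel a c p G \<longleftrightarrow> Ck_on (2 * p) G (- {0}) \<and> (\<forall>x. x \<noteq> 0 \<longrightarrow> diff_op a c G x = 0)"

section \<open>The compressed representation\<close>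

definition comp_coeff :: "(nat ^ 'd \<Rightarrow> complex) \<Rightarrow> nat \<Rightarrow> nat ^ 'd \<Rightarrow> nat ^ 'd \<Rightarrow> complex" where
  "comp_coeff a c n m = (if n \<le> m \<and> m - n \<in> mindices c then a (m - n) else 0)"

text \<open>
  Row \<open>i\<close> holds the coefficients of the relation among the derivatives of \<open>G\<close> obtained by applying
  \<open>\<partial>\<close> to the power \<open>\<nu> i\<close> to the equation \<open>L G = 0\<close>.  For order \<open>p\<close> the rows range over
  \<open>{1..N(p - c)}\<close> and the columns over \<open>{1..N(p)}\<close>, where \<open>N(p)\<close> is the number of multi-indices
  of size at most \<open>p\<close>.  The last nonzero column of each row is the derivative that is eliminated;
  the coefficients of the remaining derivatives form the compressed representation.
\<close>

definition comp_matrix ::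
    "(nat ^ 'd \<Rightarrow> complex) \<Rightarrow> nat \<Rightarrow> (nat \<Rightarrow> nat ^ 'd) \<Rightarrow> nat \<Rightarrow> nat \<Rightarrow> complex" where
  "comp_matrix a c \<nu> i k = comp_coeff a c (\<nu> i) (\<nu> k)"

definition last_col ::
    "(nat ^ 'd \<Rightarrow> complex) \<Rightarrow> nat \<Rightarrow> (nat \<Rightarrow> nat ^ 'd) \<Rightarrow> nat \<Rightarrow> nat \<Rightarrow> nat" where
  "last_col a c \<nu> p i =
     Max {k \<in> {1..card (mindices p :: (nat ^ 'd) set)}. comp_matrix a c \<nu> i k \<noteq> 0}"

definition comp_indices ::
    "(nat ^ 'd \<Rightarrow> complex) \<Rightarrow> nat \<Rightarrow> (nat \<Rightarrow> nat ^ 'd) \<Rightarrow> nat \<Rightarrow> nat set" where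
  "comp_indices a c \<nu> p =
     {1..card (mindices p :: (nat ^ 'd) set)} -
     last_col a c \<nu> p ` {1..card (mindices (p - c) :: (nat ^ 'd) set)}"

text \<open>
  Compressed local coefficient \<open>i\<close> around \<open>c2\<close> of the expansion with compressed multipole
  coefficients \<open>\<beta>\<close> around \<open>c1\<close>; only the values of \<open>\<beta>\<close> on \<^const>\<open>comp_indices\<close> matter.
\<close>

definition local_coeff ::
    "(nat ^ 'd \<Rightarrow> complex) \<Rightarrow> nat \<Rightarrow> (nat \<Rightarrow> nat ^ 'd) \<Rightarrow> nat \<Rightarrow> (real ^ 'd \<Rightarrow> complex) \<Rightarrow>
     real ^ 'd \<Rightarrow> real ^ 'd \<Rightarrow> (nat \<Rightarrow> complex) \<Rightarrow> nat \<Rightarrow> complex" where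
  "local_coeff a c \<nu> p G c1 c2 \<beta> i =
     1 / of_nat (mfact (\<nu> i)) *
     (\<Sum>q\<in>comp_indices a c \<nu> p. mderiv (\<nu> q + \<nu> i) G (c2 - c1) * \<beta> q)"

section \<open>Arithmetic work\<close>

text \<open>
  Straight-line programs over the complex numbers.  An instruction applies an arithmetic operation to
  two operands and appends the result to the registers.  Operands are inputs, precomputed
  constants, or earlier registers; reading them is free, and each instruction costs one unit.
  Invalid register accesses and divisions by zero make the run undefined.
\<close>

datatype operand = Input nat | Const nat | Reg nat

datatype arith = Add | Sub | Mul | Div

fun apply_arith :: "arith \<Rightarrow> complex \<Rightarrow> complex \<Rightarrow> complex option" where
  "apply_arith Add x y = Some (x + y)"
| "apply_arith Sub x y = Some (x - y)"
| "apply_arith Mul x y = Some (x * y)"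
| "apply_arith Div x y = (if y = 0 then None else Some (x / y))"

fun fetch ::
    "(nat \<Rightarrow> complex) \<Rightarrow> (nat \<Rightarrow> complex) \<Rightarrow> complex list \<Rightarrow> operand \<Rightarrow> complex option" where
  "fetch \<beta> w rs (Input k) = Some (\<beta> k)"
| "fetch \<beta> w rs (Const k) = Some (w k)"
| "fetch \<beta> w rs (Reg k) = (if k < length rs then Some (rs ! k) else None)"

fun run ::
    "(nat \<Rightarrow> complex) \<Rightarrow> (nat \<Rightarrow> complex) \<Rightarrow> (arith \<times> operand \<times> operand) list \<Rightarrow>
     complex list \<Rightarrow> complex list option" where
  "run \<beta> w [] rs = Some rs"
| "run \<beta> w ((f, x, y) # is) rs =
     Option.bind (fetch \<beta> w rs x) (\<lambda>u.
     Option.bind (fetch \<beta> w rs y) (\<lambda>v.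
     Option.bind (apply_arith f u v) (\<lambda>z. run \<beta> w is (rs @ [z]))))"

record program =
  code :: "(arith \<times> operand \<times> operand) list"
  outputs :: "nat \<Rightarrow> operand"

definition work :: "program \<Rightarrow> nat" where
  "work \<pi> = length (code \<pi>)"

definition computes ::
    "program \<Rightarrow> (nat \<Rightarrow> complex) \<Rightarrow> (nat \<Rightarrow> complex) \<Rightarrow> nat set \<Rightarrow> (nat \<Rightarrow> complex) \<Rightarrow> bool" where
  "computes \<pi> w \<beta> J \<gamma> \<longleftrightarrow>
     (\<exists>rs. run \<beta> w (code \<pi>) [] = Some rs \<and> (\<forall>i\<in>J. fetch \<beta> w rs (outputs \<pi> i) = Some (\<gamma> i)))"

text \<open>
  The program \<open>\<pi>\<close> and the precomputation \<open>pre\<close> are fixed before the kernel, the centers and the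
  coefficients; \<open>pre\<close> sees only the derivatives of \<open>G\<close> at \<open>c2 - c1\<close> of order at most \<open>2p\<close>.
\<close>

definition solves_m2l ::
    "(nat ^ 'd \<Rightarrow> complex) \<Rightarrow> nat \<Rightarrow> (nat \<Rightarrow> nat ^ 'd) \<Rightarrow> nat \<Rightarrow>
     program \<Rightarrow> ((nat ^ 'd \<Rightarrow> complex) \<Rightarrow> nat \<Rightarrow> complex) \<Rightarrow> bool" where
  "solves_m2l a c \<nu> p \<pi> pre \<longleftrightarrow>
     (\<forall>G c1 c2 \<beta>. is_kernel a c p G \<longrightarrow> c1 \<noteq> c2 \<longrightarrow>
        computes \<pi> (pre (\<lambda>n. if msize n \<le> 2 * p then mderiv n G (c2 - c1) else 0)) \<beta>
          (comp_indices a c \<nu> p) (local_coeff a c \<nu> p G c1 c2 \<beta>))"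

definition m2l_achievable ::
    "(nat ^ 'd \<Rightarrow> complex) \<Rightarrow> nat \<Rightarrow> (nat \<Rightarrow> nat ^ 'd) \<Rightarrow> (nat \<Rightarrow> real) \<Rightarrow> bool" where
  "m2l_achievable a c \<nu> bound \<longleftrightarrow>
     (\<exists>\<pi> pre. (\<forall>p\<ge>c. solves_m2l a c \<nu> p (\<pi> p) (pre p)) \<and>
              (\<lambda>p. real (work (\<pi> p))) \<in> O(bound))"

end

theory Submission
  imports Defs
begin

text \<open>
  Up to the factors \<open>1 / \<nu>(i)!\<close>, the translation multiplies the vector \<open>\<beta>\<close> by the matrix
  \<open>G^(\<nu>(q) + \<nu>(i))\<close>, whose entries depend only on the sum of the two multi-indices.  The set of
  multi-indices that index \<open>\<beta>\<close> and the result decides how fast this can be done.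

  The ordering is compatible with addition, so the last nonzero column in the row of \<open>n\<close> is \<open>n + l\<close>,
  where \<open>l\<close> is the largest multi-index with a nonzero coefficient in the operator.  As the ordering is
  graded, \<open>|l| = c\<close>, and hence every \<open>m \<ge> l\<close> with \<open>|m| \<le> p\<close> is such a column.  The compressed
  representation therefore keeps only multi-indices \<open>m\<close> with \<open>|m| \<le> p\<close> and \<open>m \<ge> l\<close> false
  (\<open>comp_indices_leading\<close>).

  Multi-indices in a box with sides \<open>B\<^sub>k\<close> can be coded by integers below \<open>\<Prod> B\<^sub>k\<close> in a mixed-radix
  system, and sums that stay inside the box produce no carries, so the code is additive
  (\<open>ex_radix_code\<close>).  If the box contains the sums of all pairs of kept multi-indices, the matrix
  becomes part of a Hankel matrix \<open>g(i + j)\<close> of size about \<open>\<Prod> B\<^sub>k\<close>.  Expanding \<open>g\<close> in powers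
  of a root of unity, with precomputed coefficients, turns the product into two Fourier transforms
  with a pointwise multiplication in between (\<open>derivable_hankel\<close>), at a cost of \<open>O(N log N)\<close> for
  \<open>N = \<Prod> B\<^sub>k\<close>.

  The three bounds are three ways to use this.  In general all sides are \<open>2p + 1\<close>, so \<open>N\<close> is of order
  \<open>p\<^sup>d\<close>.  If the coefficient of \<open>c e\<^sub>i\<close> is nonzero, compare multi-indices of equal size by their
  \<open>i\<close>-th component first; then \<open>l = c e\<^sub>i\<close>, the kept multi-indices have \<open>i\<close>-th component below \<open>c\<close>,
  and the \<open>i\<close>-th side shrinks to \<open>2c\<close>, so \<open>N\<close> is of order \<open>p^(d - 1)\<close>.  For \<open>d = 2\<close> some component
  of each kept multi-index is below the corresponding component of \<open>l\<close>, so only \<open>O(p)\<close>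
  multi-indices are kept, and the plain matrix-vector product takes \<open>O(p\<^sup>2)\<close> operations.
\<close>

section \<open>Straight-line programs\<close>

text \<open>
  \<open>derivable X n Y\<close> says that at most \<open>n\<close> operations lead from the functions in \<open>X\<close> to those in \<open>Y\<close>.  The
  points \<open>e\<close> stand for the data on which a program is run; an operation has to be the same at all
  points, which is the uniformity of a program.  With sets of functions in place of register
  lists, programs are composed without renumbering their registers.
\<close>

inductive derivable :: "('e \<Rightarrow> complex) set \<Rightarrow> nat \<Rightarrow> ('e \<Rightarrow> complex) set \<Rightarrow> bool" where
  available: "Y \<subseteq> X \<Longrightarrow> derivable X n Y"
| add: "f \<in> X \<Longrightarrow> g \<in> X \<Longrightarrow> derivable (insert (\<lambda>e. f e + g e) X) n Y \<Longrightarrow> derivable X (Suc n) Y"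
| mult: "f \<in> X \<Longrightarrow> g \<in> X \<Longrightarrow> derivable (insert (\<lambda>e. f e * g e) X) n Y \<Longrightarrow> derivable X (Suc n) Y"

lemma derivable_mono:
  assumes "derivable X n Y" "X \<subseteq> X'" "n \<le> n'" "Y' \<subseteq> Y"
  shows "derivable X' n' Y'"
  using assms
proof (induction arbitrary: X' n' rule: derivable.induct)
  case (available Y X n)
  then show ?case by (intro derivable.available) auto
next
  case (add f X g n Y)
  from add.prems obtain l where l: "n' = Suc l" "n \<le> l" by (cases n') auto
  have "derivable (insert (\<lambda>e. f e + g e) X') l Y'"
    by (rule add.IH) (use add.prems l in auto)
  then show ?case using add.hyps add.prems l by (auto intro: derivable.add)
next
  case (mult f X g n Y)
  from mult.prems obtain l where l: "n' = Suc l" "n \<le> l" by (cases n') auto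
  have "derivable (insert (\<lambda>e. f e * g e) X') l Y'"
    by (rule mult.IH) (use mult.prems l in auto)
  then show ?case using mult.hyps mult.prems l by (auto intro: derivable.mult)
qed

lemma derivable_keep:
  assumes "derivable X n Y" "Z \<subseteq> X"
  shows "derivable X n (Z \<union> Y)"
  using assms
proof (induction rule: derivable.induct)
  case (available Y X n)
  then show ?case by (intro derivable.available) auto
qed (blast intro: derivable.add derivable.mult)+

text \<open>
  Programs run one after the other: the second may use whatever the first has made, and the costs add.
\<close>

lemma derivable_trans:
  assumes "derivable X m Y" "derivable (X \<union> Y) n Z"
  shows "derivable X (m + n) (Y \<union> Z)"
  using assms
proof (induction rule: derivable.induct)
  case (available Y X m)
  then have "X \<union> Y = X" by auto
  with available have "derivable X n (Y \<union> Z)" by (simp add: derivable_keep)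
  then show ?case by (rule derivable_mono) auto
next
  case (add f X g m Y)
  have "derivable (insert (\<lambda>e. f e + g e) X) (m + n) (Y \<union> Z)"
    by (rule add.IH, rule derivable_mono[OF add.prems]) auto
  then show ?case using add.hyps by (auto intro: derivable.add)
next
  case (mult f X g m Y)
  have "derivable (insert (\<lambda>e. f e * g e) X) (m + n) (Y \<union> Z)"
    by (rule mult.IH, rule derivable_mono[OF mult.prems]) auto
  then show ?case using mult.hyps by (auto intro: derivable.mult)
qed

lemma derivable_add: "f \<in> X \<Longrightarrow> g \<in> X \<Longrightarrow> derivable X 1 {\<lambda>e. f e + g e}"
  unfolding One_nat_def by (rule derivable.add[of f X g 0]) (auto intro: derivable.available)

lemma derivable_mult: "f \<in> X \<Longrightarrow> g \<in> X \<Longrightarrow> derivable X 1 {\<lambda>e. f e * g e}"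
  unfolding One_nat_def by (rule derivable.mult[of f X g 0]) (auto intro: derivable.available)

lemma derivable_UN:
  assumes "finite I" "\<And>i. i \<in> I \<Longrightarrow> derivable X n (Y i)"
  shows "derivable X (card I * n) (\<Union>i\<in>I. Y i)"
  using assms
proof (induction rule: finite_induct)
  case empty
  show ?case by (auto intro: derivable.available)
next
  case (insert i I)
  then have "derivable (X \<union> Y i) (card I * n) (\<Union>i\<in>I. Y i)"
    by (auto intro: derivable_mono[of X])
  with insert have "derivable X (n + card I * n) (Y i \<union> (\<Union>i\<in>I. Y i))"
    by (intro derivable_trans) auto
  then show ?case using insert by simp
qed

lemma derivable_image:
  assumes "finite I" "\<And>i. i \<in> I \<Longrightarrow> derivable X n {f i}"
  shows "derivable X (card I * n) (f ` I)"
  using derivable_UN[OF assms] by (simp add: UNION_singleton_eq_range)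

lemma run_append:
  "run \<beta> w (is @ js) rs = Option.bind (run \<beta> w is rs) (run \<beta> w js)"
proof (induction "is" arbitrary: rs)
  case (Cons i "is")
  obtain f x y where "i = (f, x, y)" by (cases i) auto
  with Cons show ?case
    by (auto split: Option.bind_split)
qed simp

lemma fetch_append: "fetch \<beta> w rs x = Some v \<Longrightarrow> fetch \<beta> w (rs @ ss) x = Some v"
  by (cases x) (auto simp: nth_append split: if_splits)

text \<open>
  The operand must not depend on the point: it is part of the program.
\<close>

definition holds_at ::
    "('e \<Rightarrow> nat \<Rightarrow> complex) \<Rightarrow> ('e \<Rightarrow> nat \<Rightarrow> complex) \<Rightarrow> ('e \<Rightarrow> complex list) \<Rightarrow>
     operand \<Rightarrow> ('e \<Rightarrow> complex) \<Rightarrow> bool" where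
  "holds_at \<beta> w rs x f \<longleftrightarrow> (\<forall>e. fetch (\<beta> e) (w e) (rs e) x = Some (f e))"

text \<open>
  A derivation becomes code by appending one instruction per step.  The registers present before a
  step keep their positions, so operands found earlier stay valid.
\<close>

lemma derivable_run:
  fixes X Y :: "('e \<Rightarrow> complex) set" and \<beta> w :: "'e \<Rightarrow> nat \<Rightarrow> complex"
  assumes "derivable X n Y"
    and "\<And>e. run (\<beta> e) (w e) is [] = Some (rs e)"
    and "\<And>e. length (rs e) = length is"
    and "\<And>f. f \<in> X \<Longrightarrow> \<exists>x. holds_at \<beta> w rs x f"
  shows "\<exists>js ss. length js \<le> length is + n \<and> (\<forall>e. run (\<beta> e) (w e) js [] = Some (ss e)) \<and>
    (\<forall>f\<in>Y. \<exists>x. holds_at \<beta> w ss x f)"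
proof -
  have extend: "\<exists>js ss. length js = Suc (length is) \<and>
      (\<forall>e. run (\<beta> e) (w e) js [] = Some (ss e)) \<and> (\<forall>e. length (ss e) = length js) \<and>
      (\<forall>h\<in>insert (\<lambda>e. F (f e) (g e)) X. \<exists>x. holds_at \<beta> w ss x h)"
    if r: "\<And>e. run (\<beta> e) (w e) is [] = Some (rs e)" "\<And>e. length (rs e) = length is"
      "\<And>f. f \<in> X \<Longrightarrow> \<exists>x. holds_at \<beta> w rs x f" and fg: "f \<in> X" "g \<in> X"
      and op: "\<And>u v. apply_arith q u v = Some (F u v)"
    for X :: "('e \<Rightarrow> complex) set" and "is" rs f g q F
  proof -
    obtain x y where x: "holds_at \<beta> w rs x f" and y: "holds_at \<beta> w rs y g"
      using r(3) fg by metis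
    define js where "js = is @ [(q, x, y)]"
    define ss where "ss = (\<lambda>e. rs e @ [F (f e) (g e)])"
    have "run (\<beta> e) (w e) js [] = Some (ss e)" for e
      using x y by (simp add: js_def ss_def run_append r holds_at_def op)
    moreover have "holds_at \<beta> w ss (Reg (length is)) (\<lambda>e. F (f e) (g e))"
      by (auto simp: holds_at_def ss_def nth_append r)
    moreover have "\<exists>x. holds_at \<beta> w ss x h" if h: "h \<in> X" for h
    proof -
      obtain z where "holds_at \<beta> w rs z h" using r(3)[OF h] by blast
      then have "holds_at \<beta> w ss z h"
        by (simp add: holds_at_def ss_def fetch_append)
      then show ?thesis ..
    qed
    ultimately show ?thesis
      by (intro exI[of _ js] exI[of _ ss]) (auto simp: js_def ss_def r)
  qed
  show ?thesis
    using assms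
  proof (induction arbitrary: "is" rs rule: derivable.induct)
    case (available Y X n)
    then show ?case by (intro exI[of _ "is"] exI[of _ rs]) auto
  next
    case (add f X g n Y)
    obtain js ss where js: "length js = Suc (length is)"
      "\<forall>e. run (\<beta> e) (w e) js [] = Some (ss e)" "\<forall>e. length (ss e) = length js"
      "\<forall>h\<in>insert (\<lambda>e. f e + g e) X. \<exists>x. holds_at \<beta> w ss x h"
      using extend[OF add.prems add.hyps(1,2), of Add "(+)"] by force
    from add.IH[of js ss] js show ?case by auto
  next
    case (mult f X g n Y)
    obtain js ss where js: "length js = Suc (length is)"
      "\<forall>e. run (\<beta> e) (w e) js [] = Some (ss e)" "\<forall>e. length (ss e) = length js"
      "\<forall>h\<in>insert (\<lambda>e. f e * g e) X. \<exists>x. holds_at \<beta> w ss x h"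
      using extend[OF mult.prems mult.hyps(1,2), of Mul "(*)"] by force
    from mult.IH[of js ss] js show ?case by auto
  qed
qed

text \<open>
  What a program may read at no cost: functions of the precomputation data \<open>g\<close> alone, and the
  inputs \<open>\<beta>\<close>.
\<close>

definition basis :: "('g \<Rightarrow> complex) set \<Rightarrow> ('g \<times> (nat \<Rightarrow> complex) \<Rightarrow> complex) set" where
  "basis C = (\<lambda>\<phi> e. \<phi> (fst e)) ` C \<union> range (\<lambda>k e. snd e k)"

text \<open>
  The constants of a program are numbered, so a countable set of them can be stored.  Neither the
  code nor the numbering depends on \<open>g\<close> or \<open>\<beta>\<close>.
\<close>

lemma derivable_program:
  assumes "countable C" and "derivable (basis C) n (\<gamma> ` J)"
  shows "\<exists>\<pi> pre. work \<pi> \<le> n \<and>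
    (\<forall>g \<beta>. computes \<pi> (pre g) \<beta> J (\<lambda>i. \<gamma> i (g, \<beta>)))"
proof -
  define pre where "pre = (\<lambda>g k. from_nat_into C k g)"
  have base: "\<exists>x. holds_at snd (\<lambda>e. pre (fst e)) (\<lambda>e. []) x f" if f: "f \<in> basis C" for f
  proof -
    consider \<phi> where "\<phi> \<in> C" "f = (\<lambda>e. \<phi> (fst e))" | k where "f = (\<lambda>e. snd e k)"
      using f by (auto simp: basis_def)
    then show ?thesis
    proof cases
      case 1
      then obtain k where "\<phi> = from_nat_into C k"
        by (metis assms(1) from_nat_into_to_nat_on)
      with 1 show ?thesis
        by (intro exI[of _ "Const k"]) (auto simp: holds_at_def pre_def)
    next
      case 2
      then show ?thesis
        by (intro exI[of _ "Input k"]) (auto simp: holds_at_def)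
    qed
  qed
  have "\<exists>js ss. length js \<le> n \<and> (\<forall>e. run (snd e) (pre (fst e)) js [] = Some (ss e)) \<and>
      (\<forall>f\<in>\<gamma> ` J. \<exists>x. holds_at snd (\<lambda>e. pre (fst e)) ss x f)"
    using derivable_run[OF assms(2) _ _ base, of "[]"] by simp
  then obtain js ss where js: "length js \<le> n"
      "\<And>e. run (snd e) (pre (fst e)) js [] = Some (ss e)"
      "\<forall>f\<in>\<gamma> ` J. \<exists>x. holds_at snd (\<lambda>e. pre (fst e)) ss x f"
    by blast
  from js(3) have "\<forall>i\<in>J. \<exists>x. holds_at snd (\<lambda>e. pre (fst e)) ss x (\<gamma> i)" by auto
  then obtain out where out: "\<And>i. i \<in> J \<Longrightarrow> holds_at snd (\<lambda>e. pre (fst e)) ss (out i) (\<gamma> i)"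
    by metis
  define \<pi> where "\<pi> = \<lparr>code = js, outputs = out\<rparr>"
  have "computes \<pi> (pre g) \<beta> J (\<lambda>i. \<gamma> i (g, \<beta>))" for g \<beta>
    using js(2)[of "(g, \<beta>)"] out
    by (auto simp: computes_def \<pi>_def holds_at_def intro!: exI[of _ "ss (g, \<beta>)"])
  then show ?thesis
    using js(1) by (intro exI[of _ \<pi>] exI[of _ pre]) (auto simp: work_def \<pi>_def)
qed

section \<open>The fast Fourier transform\<close>

definition unit_root :: "nat \<Rightarrow> complex" where
  "unit_root k = cis (2 * pi / 2 ^ k)"

lemma unit_root_Suc_square: "unit_root (Suc k) ^ 2 = unit_root k"
  unfolding unit_root_def Complex.DeMoivre by simp

lemma unit_root_power_eq_1: "unit_root k ^ 2 ^ k = 1"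
  unfolding unit_root_def Complex.DeMoivre by simp

lemma unit_root_power_mod: "unit_root k ^ (m mod 2 ^ k) = unit_root k ^ m"
proof -
  have "unit_root k ^ m = unit_root k ^ (2 ^ k * (m div 2 ^ k) + m mod 2 ^ k)" by simp
  also have "\<dots> = unit_root k ^ (m mod 2 ^ k)"
    by (simp only: power_add power_mult unit_root_power_eq_1) simp
  finally show ?thesis ..
qed

definition dft :: "nat \<Rightarrow> (nat \<Rightarrow> 'e \<Rightarrow> complex) \<Rightarrow> nat \<Rightarrow> 'e \<Rightarrow> complex" where
  "dft k x m e = (\<Sum>j<2 ^ k. x j e * unit_root k ^ (j * m))"

text \<open>
  The transform is periodic in the frequency, so a transform of half the length also serves the upper
  half of the frequencies.
\<close>

lemma dft_mod: "dft k x (m mod 2 ^ k) = dft k x m"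
proof -
  have "unit_root k ^ (j * (m mod 2 ^ k)) = unit_root k ^ (j * m)" for j
    by (metis mod_mult_right_eq unit_root_power_mod)
  then show ?thesis by (simp add: dft_def fun_eq_iff)
qed

lemma sum_even_odd:
  "(\<Sum>j<2 * n. f j) = (\<Sum>j<n. f (2 * j)) + (\<Sum>j<n. f (2 * j + 1))" for f :: "nat \<Rightarrow> complex"
  by (induction n) (simp_all add: algebra_simps)

text \<open>
  The Cooley--Tukey step: the terms with even and with odd index are transforms of half the length,
  because the square of the finer root of unity is the coarser one.
\<close>

lemma dft_Suc:
  "dft (Suc k) x m e =
   dft k (\<lambda>j. x (2 * j)) m e + unit_root (Suc k) ^ m * dft k (\<lambda>j. x (2 * j + 1)) m e"
proof -
  have even: "unit_root (Suc k) ^ (2 * j * m) = unit_root k ^ (j * m)" for j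
    by (metis mult.assoc power_mult unit_root_Suc_square)
  have odd: "unit_root (Suc k) ^ ((2 * j + 1) * m) = unit_root (Suc k) ^ m * unit_root k ^ (j * m)" for j
    by (simp add: even[symmetric] power_add[symmetric] algebra_simps)
  show ?thesis
    unfolding dft_def power_Suc sum_even_odd even odd sum_distrib_left
    by (simp add: mult_ac)
qed

text \<open>
  Each level of the recursion spends one multiplication and one addition per frequency, which adds
  up to \<open>2 N log\<^sub>2 N\<close> operations for \<open>N = 2 ^ k\<close>.
\<close>

lemma derivable_dft:
  assumes "\<And>l j. (\<lambda>e. unit_root l ^ j) \<in> X" and "\<And>j. j < 2 ^ k \<Longrightarrow> x j \<in> X"
  shows "derivable X (2 * k * 2 ^ k) (dft k x ` {..<2 ^ k})"
  using assms(2)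
proof (induction k arbitrary: x)
  case 0
  have "dft 0 x 0 = x 0" by (simp add: dft_def fun_eq_iff)
  then show ?case using 0 by (intro available) auto
next
  case (Suc k)
  let ?E = "\<lambda>j. x (2 * j)" and ?O = "\<lambda>j. x (2 * j + 1)"
  let ?H = "dft k ?E ` {..<2 ^ k} \<union> dft k ?O ` {..<2 ^ k}"
  have E: "derivable X (2 * k * 2 ^ k) (dft k ?E ` {..<2 ^ k})"
    by (rule Suc.IH) (use Suc.prems in auto)
  have "derivable X (2 * k * 2 ^ k) (dft k ?O ` {..<2 ^ k})"
    by (rule Suc.IH) (use Suc.prems in auto)
  with E have halves: "derivable X (2 * k * 2 ^ k + 2 * k * 2 ^ k) ?H"
    by (intro derivable_trans) (auto intro: derivable_mono)
  have butterfly: "derivable (X \<union> ?H) 2 {dft (Suc k) x m}" for m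
  proof -
    have H: "dft k ?E m \<in> ?H" "dft k ?O m \<in> ?H"
      using dft_mod[of k ?E m] dft_mod[of k ?O m]
      by (auto intro!: image_eqI[of _ _ "m mod 2 ^ k"])
    let ?t = "\<lambda>e. unit_root (Suc k) ^ m * dft k ?O m e"
    have t: "derivable (X \<union> ?H) 1 {?t}"
      by (rule derivable_mult[of "\<lambda>e. unit_root (Suc k) ^ m"]) (use H assms(1) in auto)
    have "derivable (X \<union> ?H \<union> {?t}) 1 {\<lambda>e. dft k ?E m e + ?t e}"
      by (rule derivable_add) (use H in auto)
    from derivable_trans[OF t this] show ?thesis
      by (rule derivable_mono) (auto simp: dft_Suc fun_eq_iff)
  qed
  have "derivable (X \<union> ?H) (card {..<(2::nat) ^ Suc k} * 2) (dft (Suc k) x ` {..<2 ^ Suc k})"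
    by (rule derivable_image) (use butterfly in auto)
  from derivable_trans[OF halves this] show ?case
    by (rule derivable_mono) (auto simp: algebra_simps)
qed

text \<open>
  The inverse discrete Fourier transform of length \<open>2 ^ k\<close>.
\<close>

definition dft_preimage :: "nat \<Rightarrow> (nat \<Rightarrow> complex) \<Rightarrow> nat \<Rightarrow> complex" where
  "dft_preimage k h l = (\<Sum>n<2 ^ k. h n * cnj (unit_root k) ^ (n * l)) / 2 ^ k"

text \<open>
  For \<open>m \<noteq> n\<close> this is a geometric series over a root of unity different from one.
\<close>

lemma unit_root_orthogonal:
  assumes "m < 2 ^ k" "n < 2 ^ k"
  shows "(\<Sum>l<2 ^ k. (unit_root k ^ m * cnj (unit_root k) ^ n) ^ l) = (if m = n then 2 ^ k else 0)"
proof -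
  let ?z = "unit_root k ^ m * cnj (unit_root k) ^ n"
  have z: "?z = cis (2 * pi * (real m - real n) / 2 ^ k)"
    unfolding unit_root_def cis_cnj Complex.DeMoivre cis_mult by (simp add: field_simps)
  show ?thesis
  proof (cases "m = n")
    case False
    have "?z \<noteq> 1"
    proof
      assume "?z = 1"
      then have "cos (2 * pi * (real m - real n) / 2 ^ k) = 1"
        unfolding z by (metis cis.sel(1) one_complex.sel(1))
      then obtain i :: int where "2 * pi * (real m - real n) / 2 ^ k = of_int i * 2 * pi"
        unfolding cos_one_2pi_int by blast
      then have "real m - real n = 2 ^ k * of_int i"
        using pi_neq_zero by (simp add: divide_simps mult_ac)
      then have "int m - int n = 2 ^ k * i"
        by (simp flip: of_int_eq_iff[where 'a=real])
      then have "int m mod 2 ^ k = int n mod 2 ^ k"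
        by (simp add: mod_eq_dvd_iff)
      then show False using assms False
        by (metis mod_less of_nat_eq_iff of_nat_numeral of_nat_power zmod_int)
    qed
    moreover have "?z ^ 2 ^ k = 1"
    proof -
      have "?z ^ 2 ^ k = (unit_root k ^ 2 ^ k) ^ m * cnj (unit_root k ^ 2 ^ k) ^ n"
        by (simp add: power_mult_distrib mult.commute flip: power_mult)
      then show ?thesis by (simp add: unit_root_power_eq_1)
    qed
    ultimately show ?thesis using False by (simp add: geometric_sum)
  next
    case True
    then show ?thesis unfolding z by simp
  qed
qed

lemma dft_dft_preimage:
  assumes "m < 2 ^ k"
  shows "(\<Sum>l<2 ^ k. dft_preimage k h l * unit_root k ^ (l * m)) = h m"
proof -
  have "(\<Sum>l<2 ^ k. dft_preimage k h l * unit_root k ^ (l * m)) =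
      (\<Sum>l<2 ^ k. \<Sum>n<2 ^ k. h n / 2 ^ k * (unit_root k ^ m * cnj (unit_root k) ^ n) ^ l)"
    unfolding dft_preimage_def sum_divide_distrib sum_distrib_right
    by (intro sum.cong refl) (simp add: power_mult_distrib mult.commute flip: power_mult)
  also have "\<dots> = (\<Sum>n<2 ^ k. h n / 2 ^ k * (\<Sum>l<2 ^ k. (unit_root k ^ m * cnj (unit_root k) ^ n) ^ l))"
    unfolding sum_distrib_left by (rule sum.swap)
  also have "\<dots> = (\<Sum>n<2 ^ k. if n = m then h m else 0)"
    using assms by (intro sum.cong refl) (simp add: unit_root_orthogonal)
  also have "\<dots> = h m" using assms by simp
  finally show ?thesis .
qed

text \<open>
  Writing \<open>h (i + j) = (\<Sum>l. H l * \<omega> ^ (l * (i + j)))\<close> separates \<open>i\<close> from \<open>j\<close>: transform \<open>x\<close>,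
  multiply by \<open>H\<close> pointwise, and transform again.  Both transforms are forward ones, since only the
  inverse transform \<open>H\<close> of \<open>h\<close> is precomputed.  The support condition keeps \<open>i + j\<close> below \<open>2 ^ k\<close>,
  where \<open>H\<close> represents \<open>h\<close> without wrapping around.
\<close>

lemma derivable_hankel:
  assumes root: "\<And>l j. (\<lambda>e. unit_root l ^ j) \<in> X"
    and spectrum: "\<And>l. l < 2 ^ k \<Longrightarrow> (\<lambda>e. dft_preimage k (h e) l) \<in> X"
    and x: "\<And>j. j < 2 ^ k \<Longrightarrow> x j \<in> X"
    and I: "I \<subseteq> {..<2 ^ k}"
    and support: "\<And>e i j. i \<in> I \<Longrightarrow> j < 2 ^ k \<Longrightarrow> x j e \<noteq> 0 \<Longrightarrow> i + j < 2 ^ k"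
  shows "derivable X ((4 * k + 1) * 2 ^ k) ((\<lambda>i e. \<Sum>j<2 ^ k. h e (i + j) * x j e) ` I)"
proof -
  let ?Y = "dft k x ` {..<2 ^ k}"
  let ?f = "\<lambda>l e. dft_preimage k (h e) l * dft k x l e"
  let ?Z = "?f ` {..<2 ^ k}"
  have 1: "derivable X (2 * k * 2 ^ k) ?Y"
    by (rule derivable_dft[OF root x])
  have "derivable (X \<union> ?Y) (card {..<(2::nat) ^ k} * 1) ?Z"
    by (intro derivable_image derivable_mult) (auto intro: spectrum)
  from derivable_trans[OF 1 this] have 2: "derivable X (2 * k * 2 ^ k + 2 ^ k) (?Y \<union> ?Z)"
    by simp
  have 3: "derivable (X \<union> (?Y \<union> ?Z)) (2 * k * 2 ^ k) (dft k ?f ` {..<2 ^ k})"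
    by (rule derivable_dft) (use root in auto)
  have "dft k ?f i = (\<lambda>e. \<Sum>j<2 ^ k. h e (i + j) * x j e)" if i: "i \<in> I" for i
  proof
    fix e
    have "dft k ?f i e =
        (\<Sum>l<2 ^ k. \<Sum>j<2 ^ k. x j e * (dft_preimage k (h e) l * unit_root k ^ (l * (i + j))))"
      unfolding dft_def[of k ?f] unfolding dft_def sum_distrib_left sum_distrib_right
      by (intro sum.cong refl) (simp add: power_add algebra_simps)
    also have "\<dots> = (\<Sum>j<2 ^ k. x j e * (\<Sum>l<2 ^ k. dft_preimage k (h e) l * unit_root k ^ (l * (i + j))))"
      unfolding sum_distrib_left by (rule sum.swap)
    also have "\<dots> = (\<Sum>j<2 ^ k. h e (i + j) * x j e)"
    proof (intro sum.cong refl)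
      fix j :: nat assume "j \<in> {..<2 ^ k}"
      then show "x j e * (\<Sum>l<2 ^ k. dft_preimage k (h e) l * unit_root k ^ (l * (i + j))) =
          h e (i + j) * x j e"
        using support[OF i, of j e] by (cases "x j e = 0") (auto simp: dft_dft_preimage)
    qed
    finally show "dft k ?f i e = (\<Sum>j<2 ^ k. h e (i + j) * x j e)" .
  qed
  then have "(\<lambda>i e. \<Sum>j<2 ^ k. h e (i + j) * x j e) ` I = dft k ?f ` I"
    by (intro image_cong) simp_all
  also have "\<dots> \<subseteq> dft k ?f ` {..<2 ^ k}" using I by (rule image_mono)
  finally show ?thesis
    by (intro derivable_mono[OF derivable_trans[OF 2 3]]) (auto simp: algebra_simps)
qed

section \<open>Boxes of multi-indices\<close>

definition digit_box :: "('d \<Rightarrow> nat) \<Rightarrow> (nat ^ 'd) set" where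
  "digit_box B = {m. \<forall>k. m $ k < B k}"

text \<open>
  Additivity holds for all multi-indices, not only in the box: the code is a linear form.  Injectivity
  is what absence of carries gives inside the box.
\<close>

definition radix_code :: "('d \<Rightarrow> nat) \<Rightarrow> (nat ^ 'd \<Rightarrow> nat) \<Rightarrow> bool" where
  "radix_code B E \<longleftrightarrow> (\<forall>m n. E (m + n) = E m + E n) \<and> inj_on E (digit_box B) \<and>
     E ` digit_box B \<subseteq> {..<prod B UNIV}"

text \<open>
  The coordinates are added one at a time: a new coordinate gets as weight the product of the earlier
  sides, which exceeds every code in use before, so division with remainder recovers its digit.
\<close>

lemma ex_radix_code:
  fixes B :: "'d::finite \<Rightarrow> nat"
  shows "\<exists>E. radix_code B E"
proof -
  let ?b = "\<lambda>m::nat ^ 'd. m \<in> digit_box B"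
  have "\<exists>w::'d \<Rightarrow> nat. (\<forall>m n. ?b m \<longrightarrow> ?b n \<longrightarrow> (\<Sum>k\<in>S. m $ k * w k) = (\<Sum>k\<in>S. n $ k * w k) \<longrightarrow>
      (\<forall>k\<in>S. m $ k = n $ k)) \<and> (\<forall>m. ?b m \<longrightarrow> (\<Sum>k\<in>S. m $ k * w k) < prod B S)"
    if "finite S" for S
    using that
  proof (induction rule: finite_induct)
    case empty
    show ?case by simp
  next
    case (insert x S)
    then obtain w where
        inj: "\<And>m n. ?b m \<Longrightarrow> ?b n \<Longrightarrow> (\<Sum>k\<in>S. m $ k * w k) = (\<Sum>k\<in>S. n $ k * w k) \<Longrightarrow>
          \<forall>k\<in>S. m $ k = n $ k"
      and less: "\<And>m. ?b m \<Longrightarrow> (\<Sum>k\<in>S. m $ k * w k) < prod B S"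
      by blast
    define w' where "w' = w(x := prod B S)"
    have sum: "(\<Sum>k\<in>insert x S. m $ k * w' k) = m $ x * prod B S + (\<Sum>k\<in>S. m $ k * w k)"
      for m :: "nat ^ 'd"
    proof -
      have "(\<Sum>k\<in>S. m $ k * w' k) = (\<Sum>k\<in>S. m $ k * w k)"
        using insert.hyps by (intro sum.cong) (auto simp: w'_def)
      then show ?thesis using insert.hyps by (simp add: w'_def)
    qed
    have "\<forall>k\<in>insert x S. m $ k = n $ k"
      if b: "?b m" "?b n" and eq: "(\<Sum>k\<in>insert x S. m $ k * w' k) = (\<Sum>k\<in>insert x S. n $ k * w' k)"
      for m n
    proof -
      have lt: "(\<Sum>k\<in>S. m $ k * w k) < prod B S" "(\<Sum>k\<in>S. n $ k * w k) < prod B S"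
        using less b by auto
      have "m $ x = (m $ x * prod B S + (\<Sum>k\<in>S. m $ k * w k)) div prod B S"
        using lt by (simp only: div_mult_self3)  simp
      also have "\<dots> = n $ x"
        using lt eq unfolding sum by (simp only: div_mult_self3) simp
      finally show ?thesis using eq inj[OF b] unfolding sum by simp
    qed
    moreover have "(\<Sum>k\<in>insert x S. m $ k * w' k) < prod B (insert x S)" if "?b m" for m
    proof -
      have "m $ x * prod B S + (\<Sum>k\<in>S. m $ k * w k) < (m $ x + 1) * prod B S"
        using less[OF that] by simp
      also have "\<dots> \<le> B x * prod B S"
        using that by (intro mult_right_mono) (auto simp: digit_box_def Suc_le_eq)
      finally show ?thesis unfolding sum using insert.hyps by simp
    qed
    ultimately show ?case by (intro exI[of _ w']) blast
  qed
  from this[OF finite] obtain w :: "'d \<Rightarrow> nat" where w: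
      "\<And>m n. ?b m \<Longrightarrow> ?b n \<Longrightarrow> (\<Sum>k\<in>UNIV. m $ k * w k) = (\<Sum>k\<in>UNIV. n $ k * w k) \<Longrightarrow>
        \<forall>k\<in>UNIV. m $ k = n $ k"
      "\<And>m. ?b m \<Longrightarrow> (\<Sum>k\<in>UNIV. m $ k * w k) < prod B UNIV"
    by blast
  have "inj_on (\<lambda>m. \<Sum>k\<in>UNIV. m $ k * w k) (digit_box B)"
    using w(1) unfolding vec_eq_iff inj_on_def by blast
  then have "radix_code B (\<lambda>m. \<Sum>k\<in>UNIV. m $ k * w k)"
    using w(2) by (auto simp: radix_code_def distrib_right sum.distrib)
  then show ?thesis by blast
qed

lemma finite_digit_box: "finite (digit_box B)"
  and card_digit_box_le: "card (digit_box B) \<le> prod B UNIV" for B :: "'d::finite \<Rightarrow> nat"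
proof -
  obtain E where E: "radix_code B E" using ex_radix_code by blast
  then show "finite (digit_box B)"
    unfolding radix_code_def by (meson finite_lessThan inj_on_finite)
  from E show "card (digit_box B) \<le> prod B UNIV"
    unfolding radix_code_def using card_inj_on_le[of E "digit_box B" "{..<prod B UNIV}"] by simp
qed

lemma component_le_msize: "m $ k \<le> msize m"
  unfolding msize_def by (rule member_le_sum) auto

lemma msize_add: "msize (m + n) = msize m + msize n"
  by (simp add: msize_def sum.distrib)

lemma msize_axis: "msize (axis i c) = c"
  by (simp add: msize_def axis_def)

lemma finite_mindices: "finite (mindices p)"
proof (rule finite_subset)
  show "mindices p \<subseteq> digit_box (\<lambda>_. p + 1)"
    by (auto simp: mindices_def digit_box_def less_Suc_eq_le intro: le_trans[OF component_le_msize])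
qed (rule finite_digit_box)

lemma prod_UNIV_upd:
  "prod ((\<lambda>_. b)(i := x)) (UNIV :: 'd::finite set) = x * b ^ (CARD('d) - 1)" for x b :: nat
proof -
  have "prod ((\<lambda>_. b)(i := x)) (UNIV :: 'd set) = x * prod ((\<lambda>_. b)(i := x)) (UNIV - {i})"
    by (subst prod.remove[of _ i]) auto
  also have "prod ((\<lambda>_. b)(i := x)) (UNIV - {i}) = (\<Prod>k\<in>UNIV - {i}. b)"
    by (intro prod.cong) auto
  finally show ?thesis by simp
qed

section \<open>The compressed index set\<close>

text \<open>
  The multi-indices of size at most \<open>p\<close> are enumerated before all others, so they occupy exactly the
  positions up to their number.
\<close>

lemma graded_image_mindices:
  fixes \<nu> :: "nat \<Rightarrow> nat ^ 'd"
  assumes "graded_monomial_ordering \<nu>" "i \<ge> 1"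
  shows "i \<le> card (mindices p :: (nat ^ 'd) set) \<longleftrightarrow> \<nu> i \<in> mindices p"
proof -
  let ?M = "mindices p :: (nat ^ 'd) set"
  define S where "S = {j\<in>{1..}. \<nu> j \<in> ?M}"
  have bij: "bij_betw \<nu> {1..} UNIV"
    and grade: "\<And>i j. i \<ge> 1 \<Longrightarrow> j \<ge> 1 \<Longrightarrow> msize (\<nu> i) < msize (\<nu> j) \<Longrightarrow> i < j"
    using assms by (auto simp: graded_monomial_ordering_def)
  have "bij_betw \<nu> S ?M"
    unfolding bij_betw_def
  proof
    show "inj_on \<nu> S" using bij by (auto simp: S_def bij_betw_def inj_on_def)
    show "\<nu> ` S = ?M" using bij unfolding S_def bij_betw_def
      by auto
  qed
  then have card: "card S = card ?M" and fin: "finite S"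
    using finite_mindices bij_betw_same_card bij_betw_finite by blast+
  show ?thesis
  proof (rule iffI)
    assume "\<nu> i \<in> ?M"
    have "{1..i} \<subseteq> S"
    proof
      fix j assume j: "j \<in> {1..i}"
      then have "msize (\<nu> j) \<le> msize (\<nu> i)"
        using grade[of i j] assms(2) by force
      then show "j \<in> S" using \<open>\<nu> i \<in> ?M\<close> j by (auto simp: S_def mindices_def)
    qed
    then have "card {1..i} \<le> card S" by (rule card_mono[OF fin])
    then show "i \<le> card ?M" using card by simp
  next
    assume i: "i \<le> card ?M"
    show "\<nu> i \<in> ?M"
    proof (rule ccontr)
      assume "\<nu> i \<notin> ?M"
      then have "S \<subseteq> {1..<i}"
        using grade[OF _ assms(2)] by (auto simp: S_def mindices_def)
      then have "card S \<le> i - 1" using card_mono[of "{1..<i}" S] by simp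
      then show False using i card assms(2) by simp
    qed
  qed
qed

definition leading_exponent ::
    "(nat ^ 'd \<Rightarrow> complex) \<Rightarrow> nat \<Rightarrow> (nat \<Rightarrow> nat ^ 'd) \<Rightarrow> nat ^ 'd \<Rightarrow> bool" where
  "leading_exponent a c \<nu> l \<longleftrightarrow> msize l = c \<and> a l \<noteq> 0 \<and>
     (\<forall>m\<in>mindices c. a m \<noteq> 0 \<longrightarrow> inv_into {1..} \<nu> m \<le> inv_into {1..} \<nu> l)"

text \<open>
  The largest multi-index of the support has size \<open>c\<close>, because the ordering is graded and some
  multi-index of size \<open>c\<close> is in the support.
\<close>

lemma ex_leading_exponent:
  assumes "graded_monomial_ordering \<nu>" and "msize m = c" "a m \<noteq> 0"
  shows "\<exists>l. leading_exponent a c \<nu> l"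
proof -
  let ?r = "inv_into {1..} \<nu>"
  have surj: "\<nu> ` {1..} = UNIV" and
    grade: "\<And>i j. i \<ge> 1 \<Longrightarrow> j \<ge> 1 \<Longrightarrow> msize (\<nu> i) < msize (\<nu> j) \<Longrightarrow> i < j"
    using assms by (auto simp: graded_monomial_ordering_def bij_betw_def)
  have r: "\<nu> (?r n) = n" "?r n \<ge> 1" for n
    using surj f_inv_into_f[of n \<nu> "{1..}"] inv_into_into[of n \<nu> "{1..}"] by auto
  define A where "A = {m\<in>mindices c. a m \<noteq> 0}"
  have A: "finite A" "m \<in> A"
    using assms finite_mindices[of c] by (auto simp: A_def mindices_def)
  then have "Max (?r ` A) \<in> ?r ` A" by (intro Max_in) auto
  then obtain l where l: "l \<in> A" "?r l = Max (?r ` A)" by (metis (no_types, lifting) imageE)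
  then have max: "?r n \<le> ?r l" if "n \<in> A" for n using that A by simp
  have "\<not> msize l < c"
    using grade[OF r(2) r(2), of l m] max[OF A(2)] assms(2) unfolding r(1) by linarith
  then show ?thesis
    using l max by (intro exI[of _ l]) (auto simp: leading_exponent_def A_def mindices_def)
qed

text \<open>
  Row \<open>\<nu> i\<close> is the support of the operator shifted by \<open>\<nu> i\<close>, and the shift preserves the ordering, so
  it takes the largest element to the largest element.
\<close>

lemma last_col_eq:
  fixes \<nu> :: "nat \<Rightarrow> nat ^ 'd"
  assumes ord: "graded_monomial_ordering \<nu>" and l: "leading_exponent a c \<nu> l" and "c \<le> p"
    and i: "i \<in> {1..card (mindices (p - c) :: (nat ^ 'd) set)}"
  shows "last_col a c \<nu> p i = inv_into {1..} \<nu> (\<nu> i + l)"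
proof -
  let ?r = "inv_into {1..} \<nu>" and ?N = "card (mindices p :: (nat ^ 'd) set)"
  have bij: "bij_betw \<nu> {1..} UNIV"
    and shift: "\<And>i j k. i \<ge> 1 \<Longrightarrow> j \<ge> 1 \<Longrightarrow> k \<ge> 1 \<Longrightarrow> i < j \<Longrightarrow> ?r (\<nu> i + \<nu> k) < ?r (\<nu> j + \<nu> k)"
    using ord by (auto simp: graded_monomial_ordering_def)
  then have surj: "\<nu> ` {1..} = UNIV" and inj: "inj_on \<nu> {1..}" by (auto simp: bij_betw_def)
  have r: "\<nu> (?r n) = n" "?r n \<ge> 1" for n
    using surj f_inv_into_f[of n \<nu> "{1..}"] inv_into_into[of n \<nu> "{1..}"] by auto
  have row: "\<nu> i \<in> mindices (p - c)" "i \<ge> 1"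
    using i graded_image_mindices[OF ord, of i "p - c"] by auto
  have "\<nu> i + l \<in> mindices p"
    using row l \<open>c \<le> p\<close> by (auto simp: mindices_def msize_add leading_exponent_def)
  then have mem: "?r (\<nu> i + l) \<in> {k \<in> {1..?N}. comp_matrix a c \<nu> i k \<noteq> 0}"
    using l graded_image_mindices[OF ord r(2)[of "\<nu> i + l"], of p] r
    by (auto simp: comp_matrix_def comp_coeff_def leading_exponent_def mindices_def less_eq_vec_def)
  have "k \<le> ?r (\<nu> i + l)" if k: "k \<ge> 1" "comp_matrix a c \<nu> i k \<noteq> 0" for k
  proof -
    define m where "m = \<nu> k - \<nu> i"
    have m: "m \<in> mindices c" "a m \<noteq> 0" and le: "\<nu> i \<le> \<nu> k"
      using k by (auto simp: comp_matrix_def comp_coeff_def m_def split: if_splits)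
    have "\<nu> k = m + \<nu> i"
      using le by (auto simp: m_def vec_eq_iff less_eq_vec_def)
    then have "k = ?r (m + \<nu> i)" using inj k by (metis atLeast_iff inv_into_f_f)
    moreover have "?r m \<le> ?r l" using l m by (auto simp: leading_exponent_def)
    then have "?r (m + \<nu> i) \<le> ?r (l + \<nu> i)"
      using shift[OF r(2)[of m] r(2)[of l] row(2)] r by (cases "?r m = ?r l") (auto, metis order_refl)
    ultimately show ?thesis by (simp add: add.commute)
  qed
  with mem show ?thesis
    unfolding last_col_def by (intro Max_eqI) auto
qed

text \<open>
  A kept multi-index cannot be \<open>l + n\<close>: since \<open>|l| = c\<close>, this \<open>n\<close> would have size at most \<open>p - c\<close>, so it
  would be one of the rows, and \<open>l + n\<close> would be eliminated as its last column.
\<close>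

lemma comp_indices_leading:
  fixes \<nu> :: "nat \<Rightarrow> nat ^ 'd"
  assumes ord: "graded_monomial_ordering \<nu>" and l: "leading_exponent a c \<nu> l" and "c \<le> p"
    and q: "q \<in> comp_indices a c \<nu> p"
  shows "\<nu> q \<in> mindices p" "\<not> l \<le> \<nu> q"
proof -
  have inj: "inj_on \<nu> {1..}" and surj: "\<nu> ` {1..} = UNIV"
    using ord by (auto simp: graded_monomial_ordering_def bij_betw_def)
  have q1: "q \<ge> 1" "q \<le> card (mindices p :: (nat ^ 'd) set)"
    using q by (auto simp: comp_indices_def)
  then show qp: "\<nu> q \<in> mindices p" using graded_image_mindices[OF ord] by blast
  show "\<not> l \<le> \<nu> q"
  proof
    assume "l \<le> \<nu> q"
    then have split: "(\<nu> q - l) + l = \<nu> q"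
      by (auto simp: vec_eq_iff less_eq_vec_def)
    have size: "\<nu> q - l \<in> mindices (p - c)"
      using qp l arg_cong[OF split, of msize] by (auto simp: msize_add mindices_def leading_exponent_def)
    obtain i where i: "i \<ge> 1" "\<nu> i = \<nu> q - l"
      using surj by (metis UNIV_I atLeast_iff image_iff)
    then have "i \<in> {1..card (mindices (p - c) :: (nat ^ 'd) set)}"
      using graded_image_mindices[OF ord i(1), of "p - c"] size by auto
    moreover from last_col_eq[OF ord l \<open>c \<le> p\<close> this] have "last_col a c \<nu> p i = q"
      using i split inj q1 by simp
    ultimately show False using q by (auto simp: comp_indices_def)
  qed
qed


text \<open>
  Some component of a kept multi-index is smaller than that of \<open>l\<close>, hence smaller than \<open>c\<close>; the other
  \<open>d - 1\<close> components take at most \<open>p + 1\<close> values each.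
\<close>

lemma card_comp_indices_le:
  fixes \<nu> :: "nat \<Rightarrow> nat ^ 'd"
  assumes ord: "graded_monomial_ordering \<nu>" and l: "leading_exponent a c \<nu> l" and "c \<le> p"
  shows "card (comp_indices a c \<nu> p) \<le> CARD('d) * (c * (p + 1) ^ (CARD('d) - 1))"
proof -
  let ?J = "comp_indices a c \<nu> p" and ?S = "\<lambda>k::'d. digit_box ((\<lambda>_. p + 1)(k := c))"
  have "inj_on \<nu> {1..}"
    using ord by (auto simp: graded_monomial_ordering_def bij_betw_def)
  then have inj: "inj_on \<nu> ?J"
    by (rule inj_on_subset) (auto simp: comp_indices_def)
  have "\<nu> ` ?J \<subseteq> (\<Union>k. ?S k)"
  proof
    fix m assume "m \<in> \<nu> ` ?J"
    then have m: "m \<in> mindices p" "\<not> l \<le> m"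
      using comp_indices_leading[OF ord l \<open>c \<le> p\<close>] by auto
    then obtain k where "m $ k < l $ k" by (auto simp: less_eq_vec_def not_le)
    then have "m $ k < c"
      using l component_le_msize[of l k] by (simp add: leading_exponent_def)
    moreover have "m $ j < p + 1" for j
      using m component_le_msize[of m j] by (simp add: mindices_def)
    ultimately show "m \<in> (\<Union>k. ?S k)" by (auto simp: digit_box_def intro!: exI[of _ k])
  qed
  then have "card (\<nu> ` ?J) \<le> card (\<Union>k. ?S k)"
    by (intro card_mono finite_UN_I finite_digit_box) auto
  also have "\<dots> \<le> (\<Sum>k\<in>UNIV. card (?S k))" by (intro card_UN_le) auto
  also have "\<dots> \<le> (\<Sum>k\<in>(UNIV :: 'd set). c * (p + 1) ^ (CARD('d) - 1))"
    by (intro sum_mono) (metis card_digit_box_le prod_UNIV_upd)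
  finally show ?thesis using card_image[OF inj] by simp
qed

section \<open>Evaluating the translation\<close>

text \<open>
  The local coefficient as a function of the data of the program: the first component of \<open>e\<close> supplies
  the derivatives of the kernel, the second one the multipole coefficients.
\<close>

definition m2l_sum ::
    "(nat \<Rightarrow> nat ^ 'd) \<Rightarrow> nat set \<Rightarrow> nat \<Rightarrow> (nat ^ 'd \<Rightarrow> complex) \<times> (nat \<Rightarrow> complex) \<Rightarrow> complex" where
  "m2l_sum \<nu> J i e = 1 / of_nat (mfact (\<nu> i)) * (\<Sum>q\<in>J. fst e (\<nu> q + \<nu> i) * snd e q)"

text \<open>
  The precomputation sees the derivatives only up to order \<open>2p\<close>; this truncation is invisible because
  sums of two kept multi-indices have size at most \<open>2p\<close>.
\<close>

lemma m2l_achievableI: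
  assumes ord: "graded_monomial_ordering \<nu>"
    and derivable: "\<And>p. c \<le> p \<Longrightarrow> \<exists>C. countable C \<and>
      derivable (basis C) (W p) (m2l_sum \<nu> (comp_indices a c \<nu> p) ` comp_indices a c \<nu> p)"
    and W: "(\<lambda>p. real (W p)) \<in> O(bound)"
  shows "m2l_achievable a c \<nu> bound"
proof -
  let ?J = "comp_indices a c \<nu>"
  have "\<exists>\<pi> pre. solves_m2l a c \<nu> p \<pi> pre \<and> work \<pi> \<le> W p" if p: "c \<le> p" for p
  proof -
    obtain C where C: "countable C" "derivable (basis C) (W p) (m2l_sum \<nu> (?J p) ` ?J p)"
      using derivable[OF p] by blast
    obtain \<pi> pre where \<pi>: "work \<pi> \<le> W p"
        "\<And>g \<beta>. computes \<pi> (pre g) \<beta> (?J p) (\<lambda>i. m2l_sum \<nu> (?J p) i (g, \<beta>))"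
      using derivable_program[OF C] by blast
    have size: "msize (\<nu> q + \<nu> i) \<le> 2 * p" if "q \<in> ?J p" "i \<in> ?J p" for q i
    proof -
      have "\<nu> q \<in> mindices p" "\<nu> i \<in> mindices p"
        using that graded_image_mindices[OF ord] by (auto simp: comp_indices_def)
      then show ?thesis by (simp add: mindices_def msize_add)
    qed
    have "m2l_sum \<nu> (?J p) i (\<lambda>n. if msize n \<le> 2 * p then mderiv n G (c2 - c1) else 0, \<beta>) =
        local_coeff a c \<nu> p G c1 c2 \<beta> i" if "i \<in> ?J p" for G c1 c2 \<beta> i
      using size[OF _ that] by (simp add: m2l_sum_def local_coeff_def)
    then have "solves_m2l a c \<nu> p \<pi> pre"
      using \<pi>(2) by (fastforce simp: solves_m2l_def computes_def)
    with \<pi>(1) show ?thesis by blast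
  qed
  then obtain \<pi> pre where \<pi>: "\<And>p. c \<le> p \<Longrightarrow> solves_m2l a c \<nu> p (\<pi> p) (pre p)"
      "\<And>p. c \<le> p \<Longrightarrow> work (\<pi> p) \<le> W p"
    by metis
  have "(\<lambda>p. real (work (\<pi> p))) \<in> O(\<lambda>p. real (W p))"
    using \<pi>(2) by (intro bigoI[of _ 1] eventually_sequentiallyI[of c]) simp
  from landau_o.big_trans[OF this W] \<pi>(1) show ?thesis
    unfolding m2l_achievable_def by blast
qed

subsection \<open>Matrix-vector product\<close>

lemma derivable_sum_mult:
  assumes "finite J" "\<And>q. q \<in> J \<Longrightarrow> u q \<in> X" "\<And>q. q \<in> J \<Longrightarrow> v q \<in> X" "(\<lambda>e. 0) \<in> X"
  shows "derivable X (2 * card J) {\<lambda>e. \<Sum>q\<in>J. u q e * v q e}"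
  using assms
proof (induction rule: finite_induct)
  case empty
  then show ?case by (intro available) simp
next
  case (insert q J)
  let ?s = "\<lambda>e. \<Sum>q\<in>J. u q e * v q e" and ?t = "\<lambda>e. u q e * v q e"
  have "derivable (X \<union> {?s}) 1 {?t}" using insert.prems by (intro derivable_mult) auto
  moreover have "derivable X (2 * card J) {?s}" using insert by simp
  ultimately have "derivable X (2 * card J + 1) ({?s} \<union> {?t})"
    by (intro derivable_trans)
  moreover have "derivable (X \<union> ({?s} \<union> {?t})) 1 {\<lambda>e. ?t e + ?s e}"
    by (intro derivable_add) auto
  ultimately have "derivable X (2 * card J + 1 + 1) (({?s} \<union> {?t}) \<union> {\<lambda>e. ?t e + ?s e})"
    by (rule derivable_trans)
  then show ?case by (rule derivable_mono) (use insert.hyps in auto)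
qed

text \<open>
  The factor \<open>1 / \<nu>(i)!\<close> is absorbed into the precomputed matrix entries.
\<close>

lemma derivable_direct:
  assumes "finite J"
  shows "\<exists>C. countable C \<and> derivable (basis C) (2 * card J ^ 2) (m2l_sum \<nu> J ` J)"
proof -
  define \<phi> where "\<phi> = (\<lambda>(q, i) g. g (\<nu> q + \<nu> i) / of_nat (mfact (\<nu> i)) :: complex)"
  define C where "C = insert (\<lambda>g. 0) (range \<phi>)"
  have "derivable (basis C) (2 * card J) {m2l_sum \<nu> J i}" for i
  proof -
    have "m2l_sum \<nu> J i = (\<lambda>e. \<Sum>q\<in>J. \<phi> (q, i) (fst e) * snd e q)"
      by (auto simp: m2l_sum_def \<phi>_def fun_eq_iff sum_distrib_left)
    then show ?thesis
      using derivable_sum_mult[OF assms, of "\<lambda>q e. \<phi> (q, i) (fst e)" "basis C" "\<lambda>q e. snd e q"]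
      by (auto simp: basis_def C_def)
  qed
  then have "derivable (basis C) (card J * (2 * card J)) (m2l_sum \<nu> J ` J)"
    by (intro derivable_image assms)
  moreover have "countable C" by (auto simp: C_def)
  ultimately show ?thesis by (intro exI[of _ C]) (simp add: power2_eq_square mult_ac)
qed

subsection \<open>Fast convolution\<close>

text \<open>
  A mixed-radix code of a box that holds all sums of two indices turns the sum over multi-indices into
  a Hankel product; codes that belong to no index are filled with zeros.  Here the factors
  \<open>1 / \<nu>(i)!\<close> cost one more multiplication for each of the at most \<open>2 ^ k\<close> outputs.
\<close>

lemma derivable_convolution:
  fixes \<nu> :: "nat \<Rightarrow> nat ^ 'd"
  assumes inj: "inj_on \<nu> J" and sums: "\<And>q i. q \<in> J \<Longrightarrow> i \<in> J \<Longrightarrow> \<nu> q + \<nu> i \<in> digit_box B"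
    and k: "prod B UNIV \<le> 2 ^ k"
  shows "\<exists>C. countable C \<and> derivable (basis C) ((4 * k + 2) * 2 ^ k) (m2l_sum \<nu> J ` J)"
proof -
  obtain E where E: "radix_code B E" using ex_radix_code by blast
  let ?dec = "inv_into (digit_box B) E"
  have E_add: "E (m + n) = E m + E n" for m n using E by (simp add: radix_code_def)
  have dec: "?dec (E m) = m" if "m \<in> digit_box B" for m
    using E that by (simp add: radix_code_def)
  have E_less: "E m < 2 ^ k" if "m \<in> digit_box B" for m
  proof -
    have "E m < prod B UNIV" using E that by (auto simp: radix_code_def)
    then show ?thesis using k by simp
  qed
  define enc where "enc = E \<circ> \<nu>"
  have enc_add: "enc q + enc i = E (\<nu> q + \<nu> i)" for q i by (simp add: enc_def E_add)
  have enc_sum: "enc q + enc i < 2 ^ k" if "q \<in> J" "i \<in> J" for q i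
    unfolding enc_add by (rule E_less[OF sums[OF that]])
  have box: "\<nu> q \<in> digit_box B" if "q \<in> J" for q
    using sums[OF that that] by (auto simp: digit_box_def intro: le_less_trans[OF le_add1])
  have inj_enc: "inj_on enc J"
    using inj dec box unfolding enc_def comp_def inj_on_def by metis
  have enc_le: "enc ` J \<subseteq> {..<2 ^ k}" using box E_less by (auto simp: enc_def)
  then have fin: "finite J" using inj_enc by (meson finite_lessThan inj_on_finite)
  have card: "card J \<le> 2 ^ k" using card_inj_on_le[OF inj_enc enc_le] by simp

  define h where "h = (\<lambda>g n. g (?dec n) :: complex)"
  define C where "C = insert (\<lambda>g. 0) (range (\<lambda>(l, j) g. unit_root l ^ j) \<union>
    range (\<lambda>l g. dft_preimage k (h g) l) \<union> range (\<lambda>i g. 1 / of_nat (mfact (\<nu> i))))"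
  have "countable C" by (auto simp: C_def)
  have C: "(\<lambda>e. \<phi> (fst e)) \<in> basis C" if "\<phi> \<in> C" for \<phi>
    using that by (auto simp: basis_def)
  define x where "x = (\<lambda>j (e :: (nat ^ 'd \<Rightarrow> complex) \<times> (nat \<Rightarrow> complex)). if j \<in> enc ` J then snd e (inv_into J enc j) else 0 :: complex)"
  let ?f = "\<lambda>i e. \<Sum>j<2 ^ k. h (fst e) (i + j) * x j e"
  have f: "?f (enc i) e = (\<Sum>q\<in>J. fst e (\<nu> q + \<nu> i) * snd e q)" if i: "i \<in> J" for i e
  proof -
    have "?f (enc i) e = (\<Sum>j\<in>enc ` J. h (fst e) (enc i + j) * x j e)"
      by (rule sum.mono_neutral_right) (use enc_le in \<open>auto simp: x_def\<close>)
    also have "\<dots> = (\<Sum>q\<in>J. h (fst e) (enc i + enc q) * x (enc q) e)"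
      using inj_enc by (simp add: sum.reindex)
    also have "\<dots> = (\<Sum>q\<in>J. fst e (\<nu> q + \<nu> i) * snd e q)"
      by (intro sum.cong refl)
        (simp add: h_def x_def enc_add inv_into_f_f[OF inj_enc] dec sums i add.commute[of "\<nu> i"])
    finally show ?thesis .
  qed
  have "derivable (basis C) ((4 * k + 1) * 2 ^ k) (?f ` enc ` J)"
  proof (rule derivable_hankel)
    show "(\<lambda>e. unit_root l ^ j) \<in> basis C" for l j
      using C[of "\<lambda>g. unit_root l ^ j"] by (force simp: C_def)
    show "(\<lambda>e. dft_preimage k (h (fst e)) l) \<in> basis C" for l
      by (rule C) (auto simp: C_def)
    show "x j \<in> basis C" for j
    proof (cases "j \<in> enc ` J")
      case True
      then have "x j = (\<lambda>e. snd e (inv_into J enc j))" by (simp add: x_def)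
      then show ?thesis by (auto simp: basis_def)
    next
      case False
      then have "x j = (\<lambda>e. 0)" by (simp add: x_def)
      then show ?thesis using C[of "\<lambda>g. 0"] by (simp add: C_def)
    qed
    show "i + j < 2 ^ k" if "i \<in> enc ` J" "x j e \<noteq> 0" for e i j
      using that enc_sum by (auto simp: x_def split: if_splits)
  qed (rule enc_le)
  moreover have "derivable (basis C \<union> ?f ` enc ` J) (card J * 1) (m2l_sum \<nu> J ` J)"
  proof (rule derivable_image[OF fin])
    fix i assume i: "i \<in> J"
    have "(\<lambda>e. 1 / of_nat (mfact (\<nu> i))) \<in> basis C"
      using C[of "\<lambda>g. 1 / of_nat (mfact (\<nu> i))"] by (force simp: C_def)
    then have "derivable (basis C \<union> ?f ` enc ` J) 1 {\<lambda>e. 1 / of_nat (mfact (\<nu> i)) * ?f (enc i) e}"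
      using i by (intro derivable_mult) auto
    then show "derivable (basis C \<union> ?f ` enc ` J) 1 {m2l_sum \<nu> J i}"
      unfolding f[OF i] by (simp add: m2l_sum_def[abs_def])
  qed
  ultimately have "derivable (basis C) ((4 * k + 1) * 2 ^ k + card J * 1)
      (?f ` enc ` J \<union> m2l_sum \<nu> J ` J)"
    by (rule derivable_trans)
  then have "derivable (basis C) ((4 * k + 2) * 2 ^ k) (m2l_sum \<nu> J ` J)"
    by (rule derivable_mono) (use card in auto)
  with \<open>countable C\<close> show ?thesis by blast
qed

text \<open>
  The exponent of a power of two within a factor of two above \<open>n\<close>: rounding the transform
  length up to it does not affect the order of the cost.
\<close>

definition padding :: "nat \<Rightarrow> nat" where
  "padding n = (SOME k. n \<le> 2 ^ k \<and> 2 ^ k \<le> 2 * n)"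

lemma padding:
  assumes "n \<ge> 1"
  shows "n \<le> 2 ^ padding n" "2 ^ padding n \<le> 2 * n"
proof -
  obtain k where "2 ^ k \<le> n" "n < 2 ^ (k + 1)"
    using ex_power_ivl1[of 2 n] assms by auto
  then have "\<exists>k. n \<le> 2 ^ k \<and> 2 ^ k \<le> 2 * n"
    by (intro exI[of _ "k + 1"]) auto
  from someI_ex[OF this] show "n \<le> 2 ^ padding n" "2 ^ padding n \<le> 2 * n"
    by (simp_all add: padding_def)
qed

text \<open>
  With \<open>2 ^ k\<close> of order \<open>p ^ r\<close>, the exponent \<open>k\<close> is at most a constant plus \<open>r log\<^sub>2 p\<close>; the constant
  is absorbed since \<open>log\<^sub>2 p \<ge> 1\<close> for \<open>p \<ge> 2\<close>.
\<close>

lemma fft_work_bigo: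
  assumes "A \<ge> 1"
  shows "(\<lambda>p. real ((4 * padding (A * p ^ r) + 2) * 2 ^ padding (A * p ^ r)))
    \<in> O(\<lambda>p. real p ^ r * ln (real p))"
proof (rule bigoI)
  define L where "L = (4 * (ln (2 * real A) / ln 2 + real r) + 2) / ln 2"
  show "eventually (\<lambda>p. norm (real ((4 * padding (A * p ^ r) + 2) * 2 ^ padding (A * p ^ r)))
      \<le> (L * (2 * real A)) * norm (real p ^ r * ln (real p))) at_top"
  proof (rule eventually_sequentiallyI[of 2])
    fix p :: nat assume p: "p \<ge> 2"
    define k where "k = padding (A * p ^ r)"
    have "2 ^ k \<le> 2 * (A * p ^ r)"
      unfolding k_def using assms p by (intro padding(2)) simp
    then have "real (2 ^ k) \<le> real (2 * (A * p ^ r))" by (rule of_nat_mono)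
    then have pow: "2 ^ k \<le> 2 * real A * real p ^ r" by simp
    have lnp: "ln 2 \<le> ln (real p)" "0 < ln (real p)" using p by auto
    have "real k * ln 2 = ln (2 ^ k)" by (simp add: ln_realpow)
    also have "\<dots> \<le> ln (2 * real A * real p ^ r)"
      using pow assms p by (subst ln_le_cancel_iff) auto
    also have "\<dots> = ln (2 * real A) + real r * ln (real p)"
      using assms p by (simp add: ln_mult ln_realpow)
    finally have k: "real k * ln 2 \<le> ln (2 * real A) + real r * ln (real p)" .
    define t u where "t = ln (real p) / ln 2" and "u = ln (2 * real A) / ln 2"
    have "real k \<le> u + real r * t"
      using k by (simp add: t_def u_def field_simps)
    moreover have "1 \<le> t" using lnp by (simp add: t_def)
    moreover from this have "u * 1 \<le> u * t"
      using assms by (intro mult_left_mono) (auto simp: u_def)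
    ultimately have "4 * real k + 2 \<le> (4 * (u + real r) + 2) * t"
      by (simp add: algebra_simps)
    also have "\<dots> = L * ln (real p)" by (simp add: t_def u_def L_def)
    finally have "4 * real k + 2 \<le> L * ln (real p)" .
    then have "(4 * real k + 2) * 2 ^ k \<le> (L * ln (real p)) * (2 * real A * real p ^ r)"
      by (intro mult_mono pow) auto
    then show "norm (real ((4 * padding (A * p ^ r) + 2) * 2 ^ padding (A * p ^ r)))
        \<le> (L * (2 * real A)) * norm (real p ^ r * ln (real p))"
      using lnp unfolding k_def[symmetric] by (simp add: algebra_simps)
  qed
qed

lemma convolution_achievable:
  fixes \<nu> :: "nat \<Rightarrow> nat ^ 'd"
  assumes ord: "graded_monomial_ordering \<nu>" and "c \<ge> 1" "A \<ge> 1"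
    and sums: "\<And>p q i. c \<le> p \<Longrightarrow> q \<in> comp_indices a c \<nu> p \<Longrightarrow> i \<in> comp_indices a c \<nu> p \<Longrightarrow>
      \<nu> q + \<nu> i \<in> digit_box (B p)"
    and B: "\<And>p. c \<le> p \<Longrightarrow> prod (B p) UNIV \<le> A * p ^ r"
  shows "m2l_achievable a c \<nu> (\<lambda>p. real p ^ r * ln (real p))"
proof (rule m2l_achievableI[OF ord _ fft_work_bigo[OF \<open>A \<ge> 1\<close>]])
  fix p assume p: "c \<le> p"
  have "inj_on \<nu> {1..}"
    using ord by (auto simp: graded_monomial_ordering_def bij_betw_def)
  then have inj: "inj_on \<nu> (comp_indices a c \<nu> p)"
    by (rule inj_on_subset) (auto simp: comp_indices_def)
  have "A * p ^ r \<ge> 1" using assms(2,3) p by simp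
  then have "prod (B p) UNIV \<le> 2 ^ padding (A * p ^ r)"
    using B[OF p] padding(1) le_trans by blast
  from derivable_convolution[OF inj sums[OF p] this]
  show "\<exists>C. countable C \<and> derivable (basis C) ((4 * padding (A * p ^ r) + 2) * 2 ^ padding (A * p ^ r))
      (m2l_sum \<nu> (comp_indices a c \<nu> p) ` comp_indices a c \<nu> p)"
    by blast
qed

section \<open>A graded ordering with a prescribed largest variable\<close>

text \<open>
  In a graded total ordering each multi-index has only finitely many predecessors, so the ordering
  has the type of the natural numbers, and counting predecessors is the inverse of the wanted
  enumeration.
\<close>

lemma ex_graded_enumeration:
  fixes R :: "nat ^ 'd \<Rightarrow> nat ^ 'd \<Rightarrow> bool"
  assumes irrefl: "\<And>m. \<not> R m m" and trans: "\<And>m n k. R m n \<Longrightarrow> R n k \<Longrightarrow> R m k"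
    and total: "\<And>m n. m \<noteq> n \<Longrightarrow> R m n \<or> R n m"
    and graded: "\<And>m n. msize m < msize n \<Longrightarrow> R m n"
    and shift: "\<And>m n k. R m n \<Longrightarrow> R (m + k) (n + k)"
  shows "\<exists>\<nu>. graded_monomial_ordering \<nu> \<and>
    (\<forall>m n. R m n \<longrightarrow> inv_into {1..} \<nu> m < inv_into {1..} \<nu> n)"
proof -
  define below where "below = (\<lambda>m. {n. R n m})"
  have le: "msize n \<le> msize m" if "R n m" for m n
  proof (rule ccontr)
    assume "\<not> msize n \<le> msize m"
    then have "R m n" by (intro graded) simp
    with that have "R n n" by (rule trans)
    with irrefl show False by blast
  qed
  have fin: "finite (below m)" for m
    by (rule finite_subset[OF _ finite_mindices[of "msize m"]])
      (auto simp: below_def mindices_def le)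
  define rank where "rank = (\<lambda>m. card (below m) + 1)"
  have mono: "rank m < rank n" if "R m n" for m n
  proof -
    have "m \<in> below n" "m \<notin> below m" using that irrefl by (simp_all add: below_def)
    moreover have "below m \<subseteq> below n" using trans[OF _ that] by (auto simp: below_def)
    ultimately have "below m \<subset> below n" by blast
    from psubset_card_mono[OF fin this] show ?thesis by (simp add: rank_def)
  qed
  have inj: "inj rank"
  proof (rule injI, rule ccontr)
    fix m n assume "rank m = rank n" "m \<noteq> n"
    then show False using total[of m n] mono[of m n] mono[of n m] by auto
  qed
  have "rank ` UNIV = {1..}"
  proof (intro equalityI subsetI)
    fix n assume "n \<in> {1::nat..}"
    have "infinite (range (\<lambda>n. axis (undefined :: 'd) n :: nat ^ 'd))"
      by (rule range_inj_infinite) (auto simp: inj_def axis_eq_axis)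
    then have "infinite (UNIV :: (nat ^ 'd) set)"
      using finite_subset subset_UNIV by blast
    then have "infinite (range rank)"
      using inj finite_imageD by blast
    then obtain m where m: "n \<le> rank m"
      unfolding infinite_nat_iff_unbounded_le by blast
    \<comment> \<open>The initial segment up to \<open>m\<close> has \<open>rank m\<close> elements of distinct ranks, so it fills all
      ranks up to \<open>rank m\<close>.\<close>
    have "rank ` insert m (below m) \<subseteq> {1..rank m}"
      using mono by (auto simp: below_def rank_def less_imp_le)
    moreover have "card (rank ` insert m (below m)) = card {1..rank m}"
    proof -
      have "m \<notin> below m" using irrefl by (simp add: below_def)
      moreover have "inj_on rank (insert m (below m))" using inj by (rule inj_on_subset) simp
      ultimately show ?thesis using fin[of m] by (simp add: card_image rank_def)
    qed
    ultimately have "rank ` insert m (below m) = {1..rank m}"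
      by (intro card_subset_eq) auto
    then show "n \<in> range rank" using m \<open>n \<in> {1..}\<close> by force
  qed (auto simp: rank_def)
  then have bij_rank: "bij_betw rank UNIV {1..}" using inj by (simp add: bij_betw_def)
  define \<nu> where "\<nu> = inv rank"
  have bij: "bij_betw \<nu> {1..} UNIV"
    unfolding \<nu>_def by (rule bij_betw_inv_into[OF bij_rank])
  have \<nu>_rank: "\<nu> (rank m) = m" for m by (simp add: \<nu>_def inj)
  have rank_\<nu>: "rank (\<nu> i) = i" if "i \<ge> 1" for i
    unfolding \<nu>_def using that bij_rank by (intro f_inv_into_f) (auto simp: bij_betw_def)
  have inv: "inv_into {1..} \<nu> m = rank m" for m
    by (rule inv_into_f_eq) (use bij \<nu>_rank in \<open>auto simp: bij_betw_def rank_def\<close>)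
  have rank_less: "R (\<nu> i) (\<nu> j)" if "i < j" "i \<ge> 1" "j \<ge> 1" for i j
  proof (rule ccontr)
    assume "\<not> R (\<nu> i) (\<nu> j)"
    then have "\<nu> i = \<nu> j \<or> R (\<nu> j) (\<nu> i)" using total by blast
    then have "rank (\<nu> j) \<le> rank (\<nu> i)" using mono by fastforce
    then show False using that by (simp add: rank_\<nu>)
  qed
  have "below 0 = {}"
  proof -
    have False if "R n 0" for n
    proof -
      have "msize n = 0" using le[OF that] by (simp add: msize_def)
      then have "n = 0" by (simp add: msize_def vec_eq_iff)
      then show False using that irrefl by simp
    qed
    then show ?thesis by (auto simp: below_def)
  qed
  then have "\<nu> 1 = 0" using \<nu>_rank[of 0] by (simp add: rank_def)
  have "graded_monomial_ordering \<nu>"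
    unfolding graded_monomial_ordering_def inv
  proof (intro conjI allI impI)
    fix i j :: nat assume "i \<ge> 1" "j \<ge> 1" "msize (\<nu> i) < msize (\<nu> j)"
    then show "i < j" using mono[OF graded] rank_\<nu> by metis
  next
    fix i j k :: nat assume "i \<ge> 1" "j \<ge> 1" "i < j"
    then show "rank (\<nu> i + \<nu> k) < rank (\<nu> j + \<nu> k)" by (intro mono shift rank_less)
  qed fact+
  then show ?thesis using mono inv by auto
qed

text \<open>
  The graded lexicographic ordering, with the coordinates enumerated by \<open>e\<close> so that \<open>i\<close> comes first.
\<close>

lemma ex_graded_ordering_dominant:
  fixes i :: "'d::finite"
  shows "\<exists>\<nu>. graded_monomial_ordering \<nu> \<and> (\<forall>m n :: nat ^ 'd.
    msize m = msize n \<longrightarrow> m $ i < n $ i \<longrightarrow> inv_into {1..} \<nu> m < inv_into {1..} \<nu> n)"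
proof -
  define e :: "'d \<Rightarrow> nat" where "e = (\<lambda>j. if j = i then 0 else Suc (to_nat_on UNIV j))"
  have e_inj: "j = k" if "e j = e k" for j k
    using that inj_on_to_nat_on[of "UNIV :: 'd set"]
    by (auto simp: e_def inj_on_def countable_finite split: if_splits)
  define lex where "lex = (\<lambda>m n :: nat ^ 'd. \<exists>k. m $ k < n $ k \<and> (\<forall>j. e j < e k \<longrightarrow> m $ j = n $ j))"
  define R where "R = (\<lambda>m n. msize m < msize n \<or> msize m = msize n \<and> lex m n)"
  have lex_trans: "lex m o'" if mn: "lex m n" and no: "lex n o'" for m n o'
  proof -
    obtain k where k: "m $ k < n $ k" "\<And>j. e j < e k \<Longrightarrow> m $ j = n $ j"
      using mn by (auto simp: lex_def)
    obtain l where l: "n $ l < o' $ l" "\<And>j. e j < e l \<Longrightarrow> n $ j = o' $ j"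
      using no by (auto simp: lex_def)
    consider "e k < e l" | "e l < e k" | "k = l" using e_inj by (meson linorder_neqE_nat)
    then show ?thesis
    proof cases
      case 1
      then show ?thesis using k l unfolding lex_def by (intro exI[of _ k]) auto
    next
      case 2
      then show ?thesis using k l unfolding lex_def by (intro exI[of _ l]) auto
    next
      case 3
      then show ?thesis using k l unfolding lex_def by (intro exI[of _ k]) auto
    qed
  qed
  have lex_total: "lex m n \<or> lex n m" if "m \<noteq> n" for m n
  proof -
    from that obtain k where k: "m $ k \<noteq> n $ k" "\<And>j. m $ j \<noteq> n $ j \<Longrightarrow> e k \<le> e j"
      using ex_has_least_nat[of "\<lambda>k. m $ k \<noteq> n $ k" _ e] by (auto simp: vec_eq_iff)
    then have "m $ j = n $ j" if "e j < e k" for j using that by (meson not_le)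
    with k(1) show ?thesis unfolding lex_def by (metis linorder_neqE_nat)
  qed
  have "\<exists>\<nu>. graded_monomial_ordering \<nu> \<and>
      (\<forall>m n. R m n \<longrightarrow> inv_into {1..} \<nu> m < inv_into {1..} \<nu> n)"
  proof (rule ex_graded_enumeration)
    show "\<not> R m m" for m by (auto simp: R_def lex_def)
    show "R m k" if "R m n" "R n k" for m n k using that lex_trans by (auto simp: R_def)
    show "R m n \<or> R n m" if "m \<noteq> n" for m n using lex_total[OF that] by (auto simp: R_def)
    show "R m n" if "msize m < msize n" for m n using that by (simp add: R_def)
    show "R (m + k) (n + k)" if "R m n" for m n k
      using that by (auto simp: R_def lex_def msize_add)
  qed
  moreover have "R m n" if "msize m = msize n" "m $ i < n $ i" for m n
    using that by (auto simp: R_def lex_def e_def intro!: exI[of _ i])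
  ultimately show ?thesis by blast
qed

section \<open>Work bounds\<close>

text \<open>
  Among the multi-indices of size \<open>c\<close>, the largest possible \<open>i\<close>-th component singles out \<open>c e\<^sub>i\<close>, so it is
  the leading exponent when the \<open>i\<close>-th component is compared first.  Sums of two kept
  multi-indices then have \<open>i\<close>-th component below \<open>2c\<close>, and their other components are at most \<open>2p\<close>.
\<close>

lemma dominant_achievable:
  fixes a :: "nat ^ 'd \<Rightarrow> complex"
  assumes "c \<ge> 1" and i: "a (axis i c) \<noteq> 0"
  shows "\<exists>\<nu>. graded_monomial_ordering \<nu> \<and>
    m2l_achievable a c \<nu> (\<lambda>p. real p ^ (CARD('d) - 1) * ln (real p))"
proof -
  obtain \<nu> :: "nat \<Rightarrow> nat ^ 'd" where ord: "graded_monomial_ordering \<nu>" and dominant: "\<And>m n.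
      msize m = msize n \<Longrightarrow> m $ i < n $ i \<Longrightarrow> inv_into {1..} \<nu> m < inv_into {1..} \<nu> n"
    using ex_graded_ordering_dominant[of i] by blast
  obtain l where l: "leading_exponent a c \<nu> l"
    using ex_leading_exponent[OF ord, of "axis i c"] i msize_axis by blast
  have "l $ i \<ge> c"
  proof (rule ccontr)
    assume "\<not> l $ i \<ge> c"
    then have "inv_into {1..} \<nu> l < inv_into {1..} \<nu> (axis i c)"
      using l by (intro dominant) (auto simp: leading_exponent_def msize_axis)
    moreover have "inv_into {1..} \<nu> (axis i c) \<le> inv_into {1..} \<nu> l"
      using l i by (auto simp: leading_exponent_def mindices_def msize_axis)
    ultimately show False by simp
  qed
  then have zero: "l $ j = 0" if "j \<noteq> i" for j
  proof -
    have "msize l = l $ i + (\<Sum>k\<in>UNIV - {i}. l $ k)"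
      unfolding msize_def by (rule sum.remove) auto
    moreover have "msize l = c" using l by (simp add: leading_exponent_def)
    ultimately have "(\<Sum>k\<in>UNIV - {i}. l $ k) = 0" using \<open>l $ i \<ge> c\<close> by linarith
    then show ?thesis using that by simp
  qed
  have "l $ i \<le> c" using l component_le_msize[of l i] by (simp add: leading_exponent_def)
  define B where "B = (\<lambda>p. (\<lambda>_::'d. 2 * p + 1)(i := 2 * c))"
  have "m2l_achievable a c \<nu> (\<lambda>p. real p ^ (CARD('d) - 1) * ln (real p))"
  proof (rule convolution_achievable[OF ord \<open>c \<ge> 1\<close>])
    show "1 \<le> 2 * c * 3 ^ (CARD('d) - 1)" using \<open>c \<ge> 1\<close> by simp
    fix p assume p: "c \<le> p"
    have small: "\<nu> q $ i < c" "\<nu> q $ j \<le> p" if "q \<in> comp_indices a c \<nu> p" for q j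
    proof -
      from comp_indices_leading[OF ord l p that] have q: "\<nu> q \<in> mindices p" "\<not> l \<le> \<nu> q" .
      then obtain k where k: "\<nu> q $ k < l $ k" by (auto simp: less_eq_vec_def not_le)
      then have "k = i" using zero[of k] by fastforce
      then show "\<nu> q $ i < c" using k \<open>l $ i \<le> c\<close> by simp
      show "\<nu> q $ j \<le> p" using q component_le_msize[of "\<nu> q" j] by (simp add: mindices_def)
    qed
    show "\<nu> q + \<nu> n \<in> digit_box (B p)"
      if "q \<in> comp_indices a c \<nu> p" "n \<in> comp_indices a c \<nu> p" for q n
    proof -
      have "\<nu> q $ j + \<nu> n $ j \<le> 2 * p" for j
        using small(2)[OF that(1), of j] small(2)[OF that(2), of j] by simp
      then show ?thesis
        using small(1)[OF that(1)] small(1)[OF that(2)] by (auto simp: digit_box_def B_def less_Suc_eq_le)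
    qed
    have "(2 * p + 1) ^ (CARD('d) - 1) \<le> (3 * p) ^ (CARD('d) - 1)"
      using p \<open>c \<ge> 1\<close> by (intro power_mono) auto
    then show "prod (B p) UNIV \<le> 2 * c * 3 ^ (CARD('d) - 1) * p ^ (CARD('d) - 1)"
      unfolding B_def prod_UNIV_upd by (simp add: power_mult_distrib mult.assoc)
  qed
  with ord show ?thesis by blast
qed

lemma planar_achievable:
  fixes a :: "nat ^ 'd \<Rightarrow> complex"
  assumes "c \<ge> 1" and "msize m = c" "a m \<noteq> 0" and ord: "graded_monomial_ordering \<nu>"
    and d: "CARD('d) = 2"
  shows "m2l_achievable a c \<nu> (\<lambda>p. real p ^ 2)"
proof (rule m2l_achievableI[OF ord])
  obtain l where l: "leading_exponent a c \<nu> l"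
    using ex_leading_exponent[OF ord, of m c a] assms(2,3) by blast
  fix p assume p: "c \<le> p"
  let ?J = "comp_indices a c \<nu> p"
  have "finite ?J" by (simp add: comp_indices_def)
  then obtain C where C: "countable C" "derivable (basis C) (2 * card ?J ^ 2) (m2l_sum \<nu> ?J ` ?J)"
    using derivable_direct by blast
  have "card ?J \<le> 2 * (c * (p + 1))"
    using card_comp_indices_le[OF ord l p] unfolding d by simp
  then have "card ?J ^ 2 \<le> (2 * (c * (p + 1))) ^ 2" by (rule power_mono) simp
  then have "2 * card ?J ^ 2 \<le> 2 * (2 * (c * (p + 1))) ^ 2" by simp
  with C show "\<exists>C. countable C \<and> derivable (basis C) (2 * (2 * (c * (p + 1))) ^ 2) (m2l_sum \<nu> ?J ` ?J)"
    by (blast intro: derivable_mono)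
next
  show "(\<lambda>p. real (2 * (2 * (c * (p + 1))) ^ 2)) \<in> O(\<lambda>p. real p ^ 2)"
  proof (rule bigoI[of _ "real (32 * c ^ 2)"], rule eventually_sequentiallyI[of 1])
    fix p :: nat assume "p \<ge> 1"
    then have "(2 * (c * (p + 1))) ^ 2 \<le> (2 * (c * (2 * p))) ^ 2"
      by (intro power_mono mult_left_mono) auto
    then have "2 * (2 * (c * (p + 1))) ^ 2 \<le> 32 * c ^ 2 * p ^ 2"
      by (simp add: power_mult_distrib)
    then have "real (2 * (2 * (c * (p + 1))) ^ 2) \<le> real (32 * c ^ 2 * p ^ 2)"
      by (rule of_nat_mono)
    then show "norm (real (2 * (2 * (c * (p + 1))) ^ 2)) \<le> real (32 * c ^ 2) * norm (real p ^ 2)"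
      unfolding of_nat_power[symmetric] norm_of_nat of_nat_mult[symmetric] .
  qed
qed

text \<open>
  Here only the sizes of the kept multi-indices matter: the components of a sum of two of them are at
  most \<open>2p\<close>.
\<close>

lemma general_achievable:
  fixes \<nu> :: "nat \<Rightarrow> nat ^ 'd"
  assumes "c \<ge> 1" and ord: "graded_monomial_ordering \<nu>"
  shows "m2l_achievable a c \<nu> (\<lambda>p. real p ^ CARD('d) * ln (real p))"
proof (rule convolution_achievable[OF ord \<open>c \<ge> 1\<close>])
  show "(1::nat) \<le> 3 ^ CARD('d)" by simp
  fix p assume p: "c \<le> p"
  have small: "\<nu> q $ j \<le> p" if "q \<in> comp_indices a c \<nu> p" for q j
  proof -
    have "\<nu> q \<in> mindices p"
      using that graded_image_mindices[OF ord] by (auto simp: comp_indices_def)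
    then show ?thesis using component_le_msize[of "\<nu> q" j] by (simp add: mindices_def)
  qed
  show "\<nu> q + \<nu> i \<in> digit_box (\<lambda>_. 2 * p + 1)"
    if "q \<in> comp_indices a c \<nu> p" "i \<in> comp_indices a c \<nu> p" for q i
  proof -
    have "\<nu> q $ j + \<nu> i $ j \<le> 2 * p" for j
      using small[OF that(1), of j] small[OF that(2), of j] by simp
    then show ?thesis by (auto simp: digit_box_def less_Suc_eq_le)
  qed
  have "(2 * p + 1) ^ CARD('d) \<le> (3 * p) ^ CARD('d)"
    using p \<open>c \<ge> 1\<close> by (intro power_mono) auto
  then show "(\<Prod>k\<in>(UNIV :: 'd set). 2 * p + 1) \<le> 3 ^ CARD('d) * p ^ CARD('d)"
    by (simp add: power_mult_distrib)
qed

theorem theorem12: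
  fixes a :: "nat ^ 'd \<Rightarrow> complex" and c :: nat
  assumes "c \<ge> 1" and "\<exists>m. msize m = c \<and> a m \<noteq> 0"
  shows "((\<exists>i. a (axis i c) \<noteq> 0) \<longrightarrow>
           (\<exists>\<nu>. graded_monomial_ordering \<nu> \<and>
              m2l_achievable a c \<nu> (\<lambda>p. real p ^ (CARD('d) - 1) * ln (real p)))) \<and>
         (CARD('d) = 2 \<longrightarrow>
           (\<forall>\<nu>. graded_monomial_ordering \<nu> \<longrightarrow>
              m2l_achievable a c \<nu> (\<lambda>p. real p ^ 2))) \<and>
         (\<forall>\<nu>. graded_monomial_ordering \<nu> \<longrightarrow>
              m2l_achievable a c \<nu> (\<lambda>p. real p ^ CARD('d) * ln (real p)))"
  using assms dominant_achievable planar_achievable general_achievable by blast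

end
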